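(* Let $\rho^1,\rho^2\in\mathbb{R}$ be constants with $\rho^2>\rho^1$. A solution $f=f(x,t)$, $x\in\mathbb{R}$, of the Muskat contour equation $$f_t(x,t)=\frac{\rho^2-\rho^1}{2\pi}\,PV\!\int_{\mathbb{R}}\frac{(\partial_x f(x,t)-\partial_x f(x-\alpha,t))\,\alpha}{\alpha^2+(f(x,t)-f(x-\alpha,t))^2}\,d\alpha,\qquad f(x,0)=f_0(x),$$ satisfies $$\|f\|_{L^2}^2(t)+\frac{\rho^2-\rho^1}{2\pi}\int_0^t ds\int_{\mathbb{R}}d\alpha\int_{\mathbb{R}}dx\;\ln\left(1+\Big(\frac{f(x,s)-f(\alpha,s)}{x-\alpha}\Big)^2\right)=\|f_0\|_{L^2}^2 .$$ Furthermore, one has the inequality $$\int_{\mathbb{R}}dx\int_{\mathbb{R}}d\alpha\;\ln\left(1+\Big(\frac{f(x,s)-f(\alpha,s)}{x-\alpha}\Big)^2\right)\le 4\pi\sqrt{2}\,\|f\|_{L^1}(s).$$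
   Context: The function $f(\cdot,t)$ describes the interface $\{(x,f(x,t))\}$ between two incompressible immiscible fluids of constant densities $\rho^1$ and $\rho^2$ in a two-dimensional porous medium, with the denser fluid (density $\rho^2$) below; $PV$ denotes the principal value. The notation $\|f\|_{L^p}(t)$ means $\|f(\cdot,t)\|_{L^p(\mathbb{R})}$. *)

theory Defs
  imports "HOL-Analysis.Analysis"
begin

(* The value is infinite exactly when |u|^p is not integrable. *)
definition Lp_norm :: "real \<Rightarrow> (real \<Rightarrow> real) \<Rightarrow> ennreal" where
  "Lp_norm p u =
     (let I = \<integral>\<^sup>+ x. ennreal (\<bar>u x\<bar> powr p) \<partial>lborel
      in if I = \<infinity> then \<infinity> else ennreal (enn2real I powr (1 / p)))"

(* u is locally absolutely continuous with almost-everywhere derivative v.  On the real line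
   this is: v is the weak derivative of u, and u is the continuous representative. *)
definition has_ac_deriv :: "(real \<Rightarrow> real) \<Rightarrow> (real \<Rightarrow> real) \<Rightarrow> bool" where
  "has_ac_deriv u v \<longleftrightarrow>
     (\<forall>a b. a \<le> b \<longrightarrow>
        set_integrable lborel {a..b} v \<and> u b - u a = (LBINT x:{a..b}. v x))"

(* u belongs to the Sobolev space H^2 of the line, with u, u' and u'' bounded by C in L^2. *)
definition H2_bounded_by :: "ennreal \<Rightarrow> (real \<Rightarrow> real) \<Rightarrow> bool" where
  "H2_bounded_by C u \<longleftrightarrow>
     (\<exists>v w. has_ac_deriv u v \<and> has_ac_deriv v w \<and>
        Lp_norm 2 u \<le> C \<and> Lp_norm 2 v \<le> C \<and> Lp_norm 2 w \<le> C)"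

(* Principal value with respect to both the singularity at 0 and infinity. *)
definition has_PV_integral :: "(real \<Rightarrow> real) \<Rightarrow> real \<Rightarrow> bool" where
  "has_PV_integral g I \<longleftrightarrow>
     (\<forall>\<epsilon>>0. set_integrable lborel {\<alpha>. \<epsilon> < \<bar>\<alpha>\<bar> \<and> \<bar>\<alpha>\<bar> < 1 / \<epsilon>} g) \<and>
     ((\<lambda>\<epsilon>. LBINT \<alpha>:{\<alpha>. \<epsilon> < \<bar>\<alpha>\<bar> \<and> \<bar>\<alpha>\<bar> < 1 / \<epsilon>}. g \<alpha>) \<longlongrightarrow> I) (at_right 0)"

definition muskat_integrand :: "(real \<Rightarrow> real) \<Rightarrow> real \<Rightarrow> real \<Rightarrow> real" where
  "muskat_integrand u x \<alpha> =
     (deriv u x - deriv u (x - \<alpha>)) * \<alpha> / (\<alpha>\<^sup>2 + (u x - u (x - \<alpha>))\<^sup>2)"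

(* Strong solutions on the time interval [0,T].  The equation holds pointwise for 0 < t < T, the
   initial datum is attained pointwise, and the solution is bounded in H^2 uniformly in time.
   Every solution in C([0,T]; H^k), k \<ge> 3, of the usual local theory has these properties.
   For u in H^2 the representative fixed by has_ac_deriv is C^1, so deriv is the classical
   derivative. *)
definition muskat_solution ::
  "real \<Rightarrow> real \<Rightarrow> real \<Rightarrow> (real \<Rightarrow> real) \<Rightarrow> (real \<Rightarrow> real \<Rightarrow> real) \<Rightarrow> bool" where
  "muskat_solution \<rho>1 \<rho>2 T f0 f \<longleftrightarrow>
     (\<exists>C::real. \<forall>t\<in>{0..T}. H2_bounded_by (ennreal C) (\<lambda>x. f x t)) \<and>
     (\<forall>x. continuous_on {0..T} (f x)) \<and>
     (\<forall>x. f x 0 = f0 x) \<and>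
     (\<forall>t\<in>{0<..<T}. \<forall>x. \<exists>I.
        has_PV_integral (muskat_integrand (\<lambda>y. f y t) x) I \<and>
        (f x has_real_derivative (\<rho>2 - \<rho>1) / (2 * pi) * I) (at t))"

end

theory Submission
  imports Defs
begin

text \<open>
  For one time slice $u = f(\cdot,s)$ with $v = u'$ and $w = u''$ put $q(x,\alpha) = (u(x) - u(x-\alpha))/\alpha$. The kernel of
  the contour equation is $M = \partial_x \arctan q$. With the primitive
  $H(q) = q \arctan q - \frac{1}{2} \ln(1+q^2)$ of $\arctan$ one has, for $\alpha \ne 0$,
  \[ \partial_x (u \arctan q - \alpha H(q)) = u M + v(x-\alpha) \arctan q, \]
  \[ \partial_\alpha (\alpha H(q)) = v(x-\alpha) \arctan q - \textstyle\frac{1}{2} \ln(1+q^2) . \]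
  Integrating both over a strip $\epsilon \le |\alpha| \le 1/\epsilon$ and eliminating the common term expresses
  $\int u \int M$ as $-\frac{1}{2} \int\int \ln(1+q^2)$ up to edge terms (\<open>strip_identity\<close>), and
  the edge terms vanish with $\epsilon$ because $|H(q)| \le q^2$ while $\int q^2\,dx$ is at most both $\|v\|_2^2$ and
  $4\|u\|_2^2/\alpha^2$. Thus $2 \int u\, f_t\, dx$ is $-(\rho^2-\rho^1)/(2\pi)$ times the logarithmic
  integral (\<open>PV_identity\<close>), which is the energy identity in differential form.

  The analytic work is to justify $\epsilon \to 0$ under the $x$-integral and then the integration in time. Both
  rest on a majorant $g \ge 0$ of the truncated integrals with $\int |u|\, g\,dx$ bounded in terms of
  the $H^2$ bound alone (\<open>truncated_le_majorant\<close>, \<open>majorant_le\<close>). Near $\alpha = 0$ it comes from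
  $|M| \le \int_0^1 |w(x-r\alpha)|\,dr$. For $|\alpha| \ge 1$ it comes from
  $M = v(x)/\alpha - \partial_\alpha \arctan q + O(|q|/|\alpha|)$: the first term cancels by oddness, the second is a
  boundary term, the third is absolutely integrable. Only products of two translates of $u, v, w$ are ever integrated, so
  each bound is $2|ab| \le a^2 + b^2$ followed by Tonelli.
  In time, the fundamental theorem of calculus is applied to $f(x,\cdot)^2$ for fixed $x$, followed by Fubini.

  The $L^1$ estimate follows from $\ln(1 + (a-b)^2/y^2) \le \ln(1 + 2a^2/y^2) + \ln(1 + 2b^2/y^2)$ and
  $\int \ln(1 + c^2/y^2)\,dy = 2\pi|c|$.
\<close>

section \<open>Functions with a locally integrable derivative\<close>

lemma has_ac_deriv_measurable:
  assumes "has_ac_deriv u v"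
  shows "v \<in> borel_measurable borel"
proof -
  have m: "(\<lambda>x. indicator {-real n..real n} x * v x) \<in> borel_measurable borel" for n
  proof -
    have "set_integrable lborel {-real n..real n} v"
      using assms unfolding has_ac_deriv_def by auto
    then show ?thesis unfolding set_integrable_def by (auto dest: borel_measurable_integrable)
  qed
  show ?thesis
  proof (rule borel_measurable_LIMSEQ_real[OF _ m])
    fix x :: real
    have "eventually (\<lambda>n. indicator {-real n..real n} x * v x = v x) sequentially"
      using eventually_ge_at_top[of "nat \<lceil>\<bar>x\<bar>\<rceil>"]
      by eventually_elim (auto simp: indicator_def; linarith)
    then show "(\<lambda>n. indicator {-real n..real n} x * v x) \<longlonglongrightarrow> v x"
      by (rule tendsto_eventually)
  qed
qed

lemma has_ac_deriv_integral:
  assumes "has_ac_deriv u v" "a \<le> b"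
  shows "v integrable_on {a..b}" "u b - u a = integral {a..b} v"
  using assms set_borel_integral_eq_integral[of "{a..b}" v] unfolding has_ac_deriv_def by auto

lemma has_ac_deriv_continuous:
  assumes "has_ac_deriv u v"
  shows "continuous_on UNIV u"
proof -
  have "isCont u x" for x
  proof -
    have "continuous_on {x-1..x+1} (\<lambda>y. u (x-1) + integral {x-1..y} v)"
      by (intro continuous_intros indefinite_integral_continuous_1 has_ac_deriv_integral[OF assms]) simp
    then have "continuous_on {x-1..x+1} u"
    proof (rule continuous_on_eq)
      fix y assume "y \<in> {x-1..x+1}"
      then show "u (x-1) + integral {x-1..y} v = u y"
        using has_ac_deriv_integral(2)[OF assms, of "x-1" y] by simp
    qed
    then have "continuous_on {x-1<..<x+1} u" by (rule continuous_on_subset) auto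
    then show ?thesis by (simp add: continuous_on_eq_continuous_at)
  qed
  then show ?thesis by (simp add: continuous_on_eq_continuous_at)
qed

lemma has_ac_deriv_DERIV:
  assumes "has_ac_deriv u v" "continuous_on UNIV v"
  shows "(u has_real_derivative v x) (at x)"
proof -
  have "((\<lambda>y. integral {x-1..y} v) has_vector_derivative v x) (at x within {x-1..x+1})"
    by (rule integral_has_vector_derivative) (use assms continuous_on_subset in auto)
  then have d: "((\<lambda>y. u (x-1) + integral {x-1..y} v) has_vector_derivative v x) (at x within {x-1..x+1})"
    by (auto intro: derivative_eq_intros)
  have "(u has_vector_derivative v x) (at x within {x-1..x+1})"
  proof (rule has_vector_derivative_transform[OF _ _ d])
    fix y assume "y \<in> {x-1..x+1}"
    then show "u y = u (x-1) + integral {x-1..y} v"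
      using has_ac_deriv_integral(2)[OF assms(1), of "x-1" y] by simp
  qed simp
  moreover have "at x within {x-1..x+1} = at x"
    by (rule at_within_interior) (simp add: interior_atLeastAtMost_real)
  ultimately show ?thesis by (simp add: has_real_derivative_iff_has_vector_derivative)
qed

lemma has_ac_deriv_diff_le:
  assumes "has_ac_deriv u v"
  shows "ennreal \<bar>u x - u y\<bar> \<le> (\<integral>\<^sup>+ z. indicator (closed_segment x y) z * ennreal \<bar>v z\<bar> \<partial>lborel)"
proof -
  have *: "ennreal \<bar>u b - u a\<bar> \<le> (\<integral>\<^sup>+ z. indicator {a..b} z * ennreal \<bar>v z\<bar> \<partial>lborel)" if "a \<le> b" for a b
  proof -
    have i: "set_integrable lborel {a..b} v" "u b - u a = (LBINT z:{a..b}. v z)"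
      using assms that unfolding has_ac_deriv_def by auto
    have "ennreal \<bar>u b - u a\<bar> \<le> (\<integral>\<^sup>+ z. ennreal (norm (indicator {a..b} z *\<^sub>R v z)) \<partial>lborel)"
      unfolding i(2) set_lebesgue_integral_def
      using integral_norm_bound_ennreal[OF i(1)[unfolded set_integrable_def]] by simp
    also have "\<dots> = (\<integral>\<^sup>+ z. indicator {a..b} z * ennreal \<bar>v z\<bar> \<partial>lborel)"
      by (intro nn_integral_cong) (auto simp: indicator_def)
    finally show ?thesis .
  qed
  show ?thesis
  proof (cases "x \<le> y")
    case True
    then show ?thesis using *[of x y] by (simp add: closed_segment_eq_real_ivl abs_minus_commute)
  next
    case False
    then show ?thesis using *[of y x] by (simp add: closed_segment_eq_real_ivl)
  qed
qed

text \<open>Parametrising the segment from $x$ to $x - \alpha$ by $r \in [0,1]$ writes a difference quotient as an average of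
  translates of the derivative. Translates are harmless in integrals over $x$, so this form
  turns each bound on a difference quotient into an application of Tonelli, for both signs of
  $\alpha$ at once.\<close>
lemma has_ac_deriv_diff_le_scaled:
  assumes "has_ac_deriv u v" "\<alpha> \<noteq> 0"
  shows "ennreal (\<bar>u x - u (x - \<alpha>)\<bar> / \<bar>\<alpha>\<bar>) \<le> (\<integral>\<^sup>+ r\<in>{0..1}. ennreal \<bar>v (x - r * \<alpha>)\<bar> \<partial>lborel)"
proof -
  have [measurable]: "v \<in> borel_measurable borel" by (rule has_ac_deriv_measurable[OF assms(1)])
  have eq: "indicator (closed_segment x (x-\<alpha>)) (x + -\<alpha> * r) = (indicator {0..1} r :: ennreal)" for r
  proof -
    have "x + -\<alpha> * r \<in> closed_segment x (x-\<alpha>) \<longleftrightarrow> r \<in> {0..1}"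
    proof (cases "\<alpha> > 0")
      case True
      then have "\<alpha> * 0 \<le> \<alpha> * r \<longleftrightarrow> 0 \<le> r" "\<alpha> * r \<le> \<alpha> * 1 \<longleftrightarrow> r \<le> 1"
        by (metis mult_le_cancel_left_pos)+
      then show ?thesis using True by (simp add: closed_segment_eq_real_ivl) auto
    next
      case False
      then have "\<alpha> < 0" using assms(2) by simp
      then have "\<alpha> * r \<le> \<alpha> * 0 \<longleftrightarrow> 0 \<le> r" "\<alpha> * 1 \<le> \<alpha> * r \<longleftrightarrow> r \<le> 1"
        by (metis mult_le_cancel_left_neg)+
      then show ?thesis using False by (simp add: closed_segment_eq_real_ivl)
    qed
    then show ?thesis by (auto simp: indicator_def)
  qed
  have "ennreal \<bar>u x - u (x - \<alpha>)\<bar> \<le> (\<integral>\<^sup>+ z. indicator (closed_segment x (x-\<alpha>)) z * ennreal \<bar>v z\<bar> \<partial>lborel)"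
    by (rule has_ac_deriv_diff_le[OF assms(1)])
  also have "\<dots> = ennreal \<bar>-\<alpha>\<bar> * (\<integral>\<^sup>+ r. indicator (closed_segment x (x-\<alpha>)) (x + -\<alpha> * r) * ennreal \<bar>v (x + -\<alpha> * r)\<bar> \<partial>lborel)"
    by (rule nn_integral_real_affine) (use assms in auto)
  also have "\<dots> = ennreal \<bar>\<alpha>\<bar> * (\<integral>\<^sup>+ r\<in>{0..1}. ennreal \<bar>v (x - r * \<alpha>)\<bar> \<partial>lborel)"
    unfolding eq by (simp add: mult.commute)
  finally have "ennreal (1/\<bar>\<alpha>\<bar>) * ennreal \<bar>u x - u (x - \<alpha>)\<bar> \<le> ennreal (1/\<bar>\<alpha>\<bar>) * (ennreal \<bar>\<alpha>\<bar> * (\<integral>\<^sup>+ r\<in>{0..1}. ennreal \<bar>v (x - r * \<alpha>)\<bar> \<partial>lborel))"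
    by (rule mult_left_mono) simp
  then show ?thesis using assms(2)
    by (simp add: mult.assoc[symmetric] ennreal_mult[symmetric])
qed

lemma ennreal_half_sum:
  assumes "a \<ge> 0" "b \<ge> 0"
  shows "ennreal (1/2) * (ennreal a + ennreal b) = ennreal ((a + b) / 2)"
proof -
  have "ennreal (1/2) * (ennreal a + ennreal b) = ennreal (1/2) * ennreal (a + b)"
    using assms by (simp only: ennreal_plus)
  also have "\<dots> = ennreal (1/2 * (a + b))" using assms by (simp only: ennreal_mult')
  finally show ?thesis by simp
qed

lemma abs_le_one_plus_square: "\<bar>a::real\<bar> \<le> (1 + a\<^sup>2) / 2"
  using zero_le_power2[of "\<bar>a\<bar> - 1"] by (simp add: power2_eq_square algebra_simps)

text \<open>A crude Sobolev inequality: average $|u(x)| \le |u(y)| + \int |v|$ over $y \in [x, x+1]$ and use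
  $2|a| \le 1 + a^2$. What matters is that the constant is independent of $x$ and $u$.\<close>
lemma has_ac_deriv_bounded:
  assumes "has_ac_deriv u v"
    and "(\<integral>\<^sup>+ x. ennreal ((u x)\<^sup>2) \<partial>lborel) \<le> ennreal D" "(\<integral>\<^sup>+ x. ennreal ((v x)\<^sup>2) \<partial>lborel) \<le> ennreal D" "D \<ge> 0"
  shows "\<bar>u x\<bar> \<le> 1 + D"
proof -
  have [measurable]: "v \<in> borel_measurable borel" "u \<in> borel_measurable borel"
    using has_ac_deriv_measurable[OF assms(1)] has_ac_deriv_continuous[OF assms(1)]
    by (auto intro: borel_measurable_continuous_onI)
  let ?I = "indicator {x..x+1} :: real \<Rightarrow> ennreal"
  let ?A = "\<integral>\<^sup>+ z. ?I z * ennreal \<bar>v z\<bar> \<partial>lborel"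
  have i1: "(\<integral>\<^sup>+ y. ?I y \<partial>lborel) = 1" by (simp add: nn_integral_indicator emeasure_lborel_Icc)
  have half: "(\<integral>\<^sup>+ z. ?I z * ennreal \<bar>h z\<bar> \<partial>lborel) \<le> ennreal ((1+D)/2)"
    if [measurable]: "h \<in> borel_measurable borel" and "(\<integral>\<^sup>+ x. ennreal ((h x)\<^sup>2) \<partial>lborel) \<le> ennreal D" for h
  proof -
    have "(\<integral>\<^sup>+ z. ?I z * ennreal \<bar>h z\<bar> \<partial>lborel) \<le> (\<integral>\<^sup>+ z. ennreal (1/2) * (?I z + ennreal ((h z)\<^sup>2)) \<partial>lborel)"
    proof (rule nn_integral_mono)
      fix z
      have "ennreal \<bar>h z\<bar> \<le> ennreal (1/2 * (1 + (h z)\<^sup>2))" using abs_le_one_plus_square[of "h z"] by (intro ennreal_leI) simp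
      also have "\<dots> = ennreal (1/2) * (1 + ennreal ((h z)\<^sup>2))"
        by (subst ennreal_mult) auto
      finally show "?I z * ennreal \<bar>h z\<bar> \<le> ennreal (1/2) * (?I z + ennreal ((h z)\<^sup>2))"
        by (auto simp: indicator_def)
    qed
    also have "\<dots> = ennreal (1/2) * (1 + (\<integral>\<^sup>+ z. ennreal ((h z)\<^sup>2) \<partial>lborel))"
      using i1 by (subst nn_integral_cmult, simp) (subst nn_integral_add, auto)
    also have "\<dots> \<le> ennreal (1/2) * (ennreal 1 + ennreal D)"
      using that by (intro mult_left_mono add_mono) auto
    also have "\<dots> = ennreal ((1+D)/2)" using assms(4) by (intro ennreal_half_sum) auto
    finally show ?thesis .
  qed
  have "ennreal \<bar>u x\<bar> = (\<integral>\<^sup>+ y. ?I y * ennreal \<bar>u x\<bar> \<partial>lborel)"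
    by (subst nn_integral_multc) (auto simp: i1)
  also have "\<dots> \<le> (\<integral>\<^sup>+ y. (?I y * ennreal \<bar>u y\<bar> + ?I y * ?A) \<partial>lborel)"
  proof (rule nn_integral_mono)
    fix y
    show "?I y * ennreal \<bar>u x\<bar> \<le> ?I y * ennreal \<bar>u y\<bar> + ?I y * ?A"
    proof (cases "y \<in> {x..x+1}")
      case True
      have "ennreal \<bar>u x\<bar> \<le> ennreal (\<bar>u y\<bar> + \<bar>u x - u y\<bar>)" by (intro ennreal_leI) auto
      also have "\<dots> = ennreal \<bar>u y\<bar> + ennreal \<bar>u x - u y\<bar>" by simp
      also have "\<dots> \<le> ennreal \<bar>u y\<bar> + ?A"
      proof (intro add_left_mono order.trans[OF has_ac_deriv_diff_le[OF assms(1)]] nn_integral_mono)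
        fix z
        show "indicator (closed_segment x y) z * ennreal \<bar>v z\<bar> \<le> ?I z * ennreal \<bar>v z\<bar>"
          using True by (auto simp: indicator_def closed_segment_eq_real_ivl)
      qed
      finally show ?thesis using True by simp
    qed simp
  qed
  also have "\<dots> = (\<integral>\<^sup>+ z. ?I z * ennreal \<bar>u z\<bar> \<partial>lborel) + ?A"
    by (subst nn_integral_add) (auto simp: nn_integral_multc i1)
  also have "\<dots> \<le> ennreal ((1+D)/2) + ennreal ((1+D)/2)"
    by (intro add_mono half) (use assms in auto)
  also have "\<dots> = ennreal (1 + D)" using assms(4)
    by (subst ennreal_plus[symmetric]) (auto simp del: ennreal_plus)
  finally show ?thesis using assms(4) by (subst (asm) ennreal_le_iff) auto
qed

text \<open>The inequality $2|ab| \le a^2 + b^2$ replaces Cauchy--Schwarz throughout: the bound does not depend on the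
  translation $c$, and it is linear in the integrals, so it survives further integration in $c$.\<close>
lemma nn_integral_shift_product_le:
  fixes a b :: "real \<Rightarrow> real"
  assumes [measurable]: "a \<in> borel_measurable borel" "b \<in> borel_measurable borel"
    and a: "(\<integral>\<^sup>+ x. ennreal ((a x)\<^sup>2) \<partial>lborel) \<le> ennreal D" and b: "(\<integral>\<^sup>+ x. ennreal ((b x)\<^sup>2) \<partial>lborel) \<le> ennreal D"
    and "D \<ge> 0"
  shows "(\<integral>\<^sup>+ x. ennreal (\<bar>a x\<bar> * \<bar>b (x + c)\<bar>) \<partial>lborel) \<le> ennreal D"
proof -
  have sh: "(\<integral>\<^sup>+ x. ennreal ((b (x + c))\<^sup>2) \<partial>lborel) = (\<integral>\<^sup>+ x. ennreal ((b x)\<^sup>2) \<partial>lborel)"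
    using nn_integral_real_affine[of "\<lambda>x. ennreal ((b x)\<^sup>2)" 1 c] by (simp add: add.commute)
  have "(\<integral>\<^sup>+ x. ennreal (\<bar>a x\<bar> * \<bar>b (x + c)\<bar>) \<partial>lborel) \<le> (\<integral>\<^sup>+ x. ennreal (1/2) * (ennreal ((a x)\<^sup>2) + ennreal ((b (x+c))\<^sup>2)) \<partial>lborel)"
  proof (rule nn_integral_mono)
    fix x
    have "\<bar>a x\<bar> * \<bar>b (x + c)\<bar> \<le> 1/2 * ((a x)\<^sup>2 + (b (x+c))\<^sup>2)"
      using zero_le_power2[of "\<bar>a x\<bar> - \<bar>b (x+c)\<bar>"] by (simp add: power2_diff)
    then have "ennreal (\<bar>a x\<bar> * \<bar>b (x + c)\<bar>) \<le> ennreal (1/2 * ((a x)\<^sup>2 + (b (x+c))\<^sup>2))"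
      by (rule ennreal_leI)
    also have "\<dots> = ennreal (1/2) * (ennreal ((a x)\<^sup>2) + ennreal ((b (x+c))\<^sup>2))"
      by (subst ennreal_half_sum) auto
    finally show "ennreal (\<bar>a x\<bar> * \<bar>b (x + c)\<bar>) \<le> ennreal (1/2) * (ennreal ((a x)\<^sup>2) + ennreal ((b (x+c))\<^sup>2))" .
  qed
  also have "\<dots> = ennreal (1/2) * ((\<integral>\<^sup>+ x. ennreal ((a x)\<^sup>2) \<partial>lborel) + (\<integral>\<^sup>+ x. ennreal ((b x)\<^sup>2) \<partial>lborel))"
    by (subst nn_integral_cmult, simp) (subst nn_integral_add, auto simp: sh)
  also have "\<dots> \<le> ennreal (1/2) * (ennreal D + ennreal D)"
    by (intro mult_left_mono add_mono a b) auto
  also have "\<dots> = ennreal D" using \<open>D \<ge> 0\<close> by (subst ennreal_half_sum) auto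
  finally show ?thesis .
qed

text \<open>Integration by parts on the line. Writing $\varphi(x+1) - \varphi(x) = \int_0^1 \varphi'(x+r)\,dr$ and integrating in
  $x$ gives $0$ on the left, by translation invariance, and $\int \varphi'$ on the right.\<close>
lemma integral_derivative_zero:
  fixes \<phi> \<phi>' :: "real \<Rightarrow> real"
  assumes d: "\<And>x. (\<phi> has_real_derivative \<phi>' x) (at x)"
    and i: "integrable lborel \<phi>" and i': "integrable lborel \<phi>'" 
    and c: "continuous_on UNIV \<phi>'"
  shows "(LBINT x. \<phi>' x) = 0"
proof -
  have [measurable]: "\<phi>' \<in> borel_measurable borel" using c by (rule borel_measurable_continuous_onI)
  have int: "integrable (lborel \<Otimes>\<^sub>M lborel) (\<lambda>(x, r). indicator {0..1::real} r * \<phi>' (x + r))"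
  proof (rule integrableI_bounded)
    have "(\<integral>\<^sup>+ p. ennreal (norm (case p of (x, r) \<Rightarrow> indicator {0..1::real} r * \<phi>' (x + r))) \<partial>(lborel \<Otimes>\<^sub>M lborel))
       = (\<integral>\<^sup>+ r. \<integral>\<^sup>+ x. ennreal (norm (indicator {0..1::real} r * \<phi>' (x + r))) \<partial>lborel \<partial>lborel)"
      by (subst lborel_pair.nn_integral_snd[symmetric]) auto
    also have "\<dots> = (\<integral>\<^sup>+ r. indicator {0..1::real} r * (\<integral>\<^sup>+ x. ennreal (norm (\<phi>' x)) \<partial>lborel) \<partial>lborel)"
    proof (rule nn_integral_cong)
      fix r
      have "(\<integral>\<^sup>+ x. ennreal (norm (\<phi>' (x + r))) \<partial>lborel) = (\<integral>\<^sup>+ x. ennreal (norm (\<phi>' x)) \<partial>lborel)"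
        using nn_integral_real_affine[of "\<lambda>x. ennreal (norm (\<phi>' x))" 1 r] by (simp add: add.commute)
      then show "(\<integral>\<^sup>+ x. ennreal (norm (indicator {0..1::real} r * \<phi>' (x + r))) \<partial>lborel) = indicator {0..1::real} r * (\<integral>\<^sup>+ x. ennreal (norm (\<phi>' x)) \<partial>lborel)"
        by (auto simp: indicator_def)
    qed
    also have "\<dots> = (\<integral>\<^sup>+ x. ennreal (norm (\<phi>' x)) \<partial>lborel)"
      by (subst nn_integral_multc) auto
    also have "\<dots> < \<infinity>" using i' by (simp add: integrable_iff_bounded)
    finally show "(\<integral>\<^sup>+ p. ennreal (norm (case p of (x, r) \<Rightarrow> indicator {0..1::real} r * \<phi>' (x + r))) \<partial>(lborel \<Otimes>\<^sub>M lborel)) < \<infinity>" .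
  qed measurable
  have "(LBINT x. LBINT r. indicator {0..1::real} r * \<phi>' (x + r)) = (LBINT r. LBINT x. indicator {0..1::real} r * \<phi>' (x + r))"
    by (rule lborel_pair.Fubini_integral[OF int, symmetric])
  moreover have "(LBINT r. LBINT x. indicator {0..1::real} r * \<phi>' (x + r)) = (LBINT x. \<phi>' x)"
  proof -
    have "(LBINT x. \<phi>' (x + r)) = (LBINT x. \<phi>' x)" for r
      using lborel_integral_real_affine[of 1 \<phi>' r] by (simp add: add.commute)
    then show ?thesis by simp
  qed
  moreover have "(LBINT x. LBINT r. indicator {0..1::real} r * \<phi>' (x + r)) = (LBINT x. \<phi> (x + 1) - \<phi> x)"
  proof (rule Bochner_Integration.integral_cong[OF refl])
    fix x
    have "(LBINT r. indicator {0..1::real} r *\<^sub>R \<phi>' (x + r)) = \<phi> (x + 1) - \<phi> (x + 0)"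
    proof (rule integral_FTC_Icc)
      fix r :: real
      have "((\<lambda>r. \<phi> (x + r)) has_real_derivative \<phi>' (x + r)) (at r)"
        using d[of "r + x"] by (simp add: DERIV_shift add.commute)
      then show "((\<lambda>r. \<phi> (x + r)) has_vector_derivative \<phi>' (x + r)) (at r within {0..1})"
        by (simp add: has_real_derivative_iff_has_vector_derivative has_vector_derivative_at_within)
    next
      show "continuous_on {0..1} (\<lambda>r. \<phi>' (x + r))"
        by (intro continuous_on_compose2[OF c] continuous_intros) auto
    qed simp
    then show "(LBINT r. indicator {0..1::real} r * \<phi>' (x + r)) = \<phi> (x + 1) - \<phi> x" by simp
  qed
  moreover have "(LBINT x. \<phi> (x + 1) - \<phi> x) = 0"
  proof -
    have "integrable lborel (\<lambda>x. \<phi> (x + 1))" 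
      using lborel_integrable_real_affine[OF i, of 1 1] by (simp add: add.commute)
    moreover have "(LBINT x. \<phi> (x + 1)) = (LBINT x. \<phi> x)"
      using lborel_integral_real_affine[of 1 \<phi> 1] by (simp add: add.commute)
    ultimately show ?thesis using i by simp
  qed
  ultimately show ?thesis by simp
qed

section \<open>The slope kernel and its exact derivatives\<close>

lemma abs_arctan_le: "\<bar>arctan q\<bar> \<le> \<bar>q\<bar>"
proof -
  have *: "arctan x \<le> x" if "x \<ge> 0" for x
  proof -
    have "x - arctan x \<ge> 0 - arctan 0"
    proof (rule DERIV_nonneg_imp_nondecreasing[OF that])
      fix y :: real
      have "((\<lambda>x. x - arctan x) has_real_derivative (1 - inverse (1 + y\<^sup>2))) (at y)"
        by (auto intro!: derivative_eq_intros)
      moreover have "1 - inverse (1 + y\<^sup>2) \<ge> 0"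
        by (simp add: inverse_le_1_iff)
      ultimately show "\<exists>z. ((\<lambda>x. x - arctan x) has_real_derivative z) (at y) \<and> z \<ge> 0" by blast
    qed
    then show ?thesis by simp
  qed
  show ?thesis using *[of "\<bar>q\<bar>"] by (cases "q \<ge> 0") (auto simp: arctan_minus)
qed

definition arctan_primitive :: "real \<Rightarrow> real" where
  "arctan_primitive q = q * arctan q - ln (1 + q\<^sup>2) / 2"

lemma one_plus_square_pos [simp]: "0 < 1 + (q::real)\<^sup>2" "1 + (q::real)\<^sup>2 \<noteq> 0"
  by (smt (verit) zero_le_power2)+

lemma DERIV_arctan_primitive: "(arctan_primitive has_real_derivative arctan q) (at q)"
proof -
  have "((\<lambda>q::real. 1 + q\<^sup>2) has_real_derivative 2 * q) (at q)"
    by (auto intro!: derivative_eq_intros)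
  then have "((\<lambda>q. q * arctan q - ln (1 + q\<^sup>2) / 2) has_real_derivative
      1 * arctan q + inverse (1 + q\<^sup>2) * q - inverse (1 + q\<^sup>2) * (2 * q) / 2) (at q)"
    by (intro DERIV_diff DERIV_mult DERIV_ident DERIV_arctan DERIV_cdivide DERIV_chain2[OF DERIV_ln])
       simp_all
  then show ?thesis unfolding arctan_primitive_def [abs_def] by simp
qed

lemma ln_one_plus_square_bounds: "0 \<le> ln (1 + (q::real)\<^sup>2)" "ln (1 + (q::real)\<^sup>2) \<le> q\<^sup>2"
  using ln_add_one_self_le_self[of "q\<^sup>2"] by auto

lemma abs_arctan_primitive_le: "\<bar>arctan_primitive q\<bar> \<le> q\<^sup>2"
proof -
  have "0 \<le> q * arctan q" by (cases "q \<ge> 0") (auto simp: mult_nonpos_nonpos)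
  moreover have "\<bar>q * arctan q\<bar> \<le> \<bar>q\<bar> * \<bar>q\<bar>"
    unfolding abs_mult by (intro mult_left_mono abs_arctan_le) simp
  then have "q * arctan q \<le> q\<^sup>2" by (simp add: power2_eq_square)
  ultimately show ?thesis
    using ln_one_plus_square_bounds[of q] unfolding arctan_primitive_def abs_le_iff by linarith
qed

definition slope :: "(real \<Rightarrow> real) \<Rightarrow> real \<Rightarrow> real \<Rightarrow> real" where
  "slope u x \<alpha> = (u x - u (x - \<alpha>)) / \<alpha>"

lemma slope_square_le: 
  "(slope u x \<alpha>)\<^sup>2 \<le> (2 / \<alpha>\<^sup>2) * (\<bar>u x\<bar> * \<bar>u x\<bar> + \<bar>u (x - \<alpha>)\<bar> * \<bar>u (x - \<alpha>)\<bar>)"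
proof -
  have "(u x - u (x - \<alpha>))\<^sup>2 \<le> 2 * (\<bar>u x\<bar> * \<bar>u x\<bar> + \<bar>u (x - \<alpha>)\<bar> * \<bar>u (x - \<alpha>)\<bar>)"
    using zero_le_power2[of "u x + u (x - \<alpha>)"] by (simp add: power2_eq_square algebra_simps)
  then have "(u x - u (x - \<alpha>))\<^sup>2 / \<alpha>\<^sup>2 \<le> 2 * (\<bar>u x\<bar> * \<bar>u x\<bar> + \<bar>u (x - \<alpha>)\<bar> * \<bar>u (x - \<alpha>)\<bar>) / \<alpha>\<^sup>2"
    by (rule divide_right_mono) simp
  then show ?thesis by (simp add: slope_def power_divide)
qed

lemma abs_slope_le: "\<bar>slope u x \<alpha>\<bar> \<le> (1 / \<bar>\<alpha>\<bar>) * (\<bar>u x\<bar> + \<bar>u (x - \<alpha>)\<bar>)"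
  by (auto simp: slope_def abs_divide intro!: divide_right_mono)

text \<open>Every use of Fubini below is on a strip of bounded width, where it suffices to bound the horizontal integrals
  uniformly.\<close>
lemma integrable_strip:
  fixes K :: "real \<Rightarrow> real \<Rightarrow> real"
  assumes [measurable]: "(\<lambda>(x, \<alpha>). K x \<alpha>) \<in> borel_measurable (borel \<Otimes>\<^sub>M borel)"
    and le: "\<And>\<alpha>. \<alpha> \<in> {a..b} \<Longrightarrow> (\<integral>\<^sup>+ x. ennreal \<bar>K x \<alpha>\<bar> \<partial>lborel) \<le> ennreal B"
  shows "integrable (lborel \<Otimes>\<^sub>M lborel) (\<lambda>(x, \<alpha>). indicator {a..b} \<alpha> * K x \<alpha>)"
proof (rule integrableI_bounded)
  have "(\<integral>\<^sup>+ p. ennreal (norm (case p of (x, \<alpha>) \<Rightarrow> indicator {a..b} \<alpha> * K x \<alpha>)) \<partial>(lborel \<Otimes>\<^sub>M lborel))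
      = (\<integral>\<^sup>+ \<alpha>. \<integral>\<^sup>+ x. ennreal (norm (indicator {a..b} \<alpha> * K x \<alpha>)) \<partial>lborel \<partial>lborel)"
    by (subst lborel_pair.nn_integral_snd[symmetric]) auto
  also have "\<dots> \<le> (\<integral>\<^sup>+ \<alpha>. ennreal B * indicator {a..b} \<alpha> \<partial>lborel)"
  proof (rule nn_integral_mono)
    fix \<alpha> show "(\<integral>\<^sup>+ x. ennreal (norm (indicator {a..b} \<alpha> * K x \<alpha>)) \<partial>lborel) \<le> ennreal B * indicator {a..b} \<alpha>"
      using le[of \<alpha>] by (cases "\<alpha> \<in> {a..b}") auto
  qed
  also have "\<dots> < \<infinity>" by (subst nn_integral_cmult_indicator) (auto simp: ennreal_mult_less_top emeasure_lborel_Icc_eq)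
  finally show "(\<integral>\<^sup>+ p. ennreal (norm (case p of (x, \<alpha>) \<Rightarrow> indicator {a..b} \<alpha> * K x \<alpha>)) \<partial>(lborel \<Otimes>\<^sub>M lborel)) < \<infinity>" .
qed measurable

text \<open>One time slice of a solution. The single number $D$ bounds all three squared norms; all estimates
  depend on the slice only through $D$, which makes them uniform in time.\<close>
locale H2_profile =
  fixes u v w :: "real \<Rightarrow> real" and D :: real
  assumes uv: "has_ac_deriv u v" and vw: "has_ac_deriv v w" and D_nonneg: "D \<ge> 0"
    and u_sq: "(\<integral>\<^sup>+ x. ennreal ((u x)\<^sup>2) \<partial>lborel) \<le> ennreal D"
    and v_sq: "(\<integral>\<^sup>+ x. ennreal ((v x)\<^sup>2) \<partial>lborel) \<le> ennreal D"
    and w_sq: "(\<integral>\<^sup>+ x. ennreal ((w x)\<^sup>2) \<partial>lborel) \<le> ennreal D"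
begin

abbreviation "q \<equiv> slope u"
abbreviation "M \<equiv> muskat_integrand u"

lemma cont_u: "continuous_on UNIV u" and cont_v: "continuous_on UNIV v"
  using has_ac_deriv_continuous uv vw by auto

lemma measurable_uvw [measurable]:
  "u \<in> borel_measurable borel" "v \<in> borel_measurable borel" "w \<in> borel_measurable borel"
  using has_ac_deriv_measurable uv vw cont_u by (auto intro: borel_measurable_continuous_onI)

lemma DERIV_u: "(u has_real_derivative v x) (at x)"
  by (rule has_ac_deriv_DERIV[OF uv cont_v])

lemma M_eq: "M x \<alpha> = (v x - v (x - \<alpha>)) / \<alpha> / (1 + (q x \<alpha>)\<^sup>2)" if "\<alpha> \<noteq> 0"
proof -
  have "deriv u y = v y" for y using DERIV_u by (rule DERIV_imp_deriv)
  moreover have "\<alpha>\<^sup>2 + (u x - u (x - \<alpha>))\<^sup>2 = \<alpha>\<^sup>2 * (1 + (q x \<alpha>)\<^sup>2)"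
    using that by (simp add: slope_def power_divide field_simps)
  ultimately show ?thesis using that
    by (simp add: muskat_integrand_def power2_eq_square)
qed

lemma q_DERIV_x:
  assumes "\<alpha> \<noteq> 0"
  shows "((\<lambda>x. q x \<alpha>) has_real_derivative (v x - v (x - \<alpha>)) / \<alpha>) (at x)"
  unfolding slope_def using assms
  by (auto intro!: derivative_eq_intros DERIV_u DERIV_chain2[OF DERIV_u])

lemma q_DERIV_\<alpha>:
  assumes "\<alpha> \<noteq> 0"
  shows "((\<lambda>\<alpha>. q x \<alpha>) has_real_derivative (v (x - \<alpha>) - q x \<alpha>) / \<alpha>) (at \<alpha>)"
  unfolding slope_def using assms
  by (auto intro!: derivative_eq_intros DERIV_chain2[OF DERIV_u] simp: field_simps)

lemma cont_q:
  shows "\<alpha> \<noteq> 0 \<Longrightarrow> continuous_on UNIV (\<lambda>x. q x \<alpha>)"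
    and "0 \<notin> A \<Longrightarrow> continuous_on A (\<lambda>\<alpha>. q x \<alpha>)"
  unfolding slope_def
  by (intro continuous_intros continuous_on_compose2[OF cont_u]; auto)+

text \<open>The reason for the energy identity is a pair of exact derivatives. Let $H$ be the primitive of $\arctan$
  and $G(x,\alpha) = \alpha H(q(x,\alpha))$. The kernel $M$ is $\partial_x \arctan q$, hence
  $\partial_x (u \arctan q - G) = u M + v(x-\alpha) \arctan q$; the $\alpha$-derivative of $G$ computed next
  contains the same term $v(x-\alpha) \arctan q$ together with the logarithm.\<close>
lemma DERIV_x:
  assumes "\<alpha> \<noteq> 0"
  shows "((\<lambda>x. u x * arctan (q x \<alpha>) - \<alpha> * arctan_primitive (q x \<alpha>)) has_real_derivative
           (u x * M x \<alpha> + v (x - \<alpha>) * arctan (q x \<alpha>))) (at x)"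
proof -
  let ?q' = "(v x - v (x - \<alpha>)) / \<alpha>"
  have "((\<lambda>x. u x * arctan (q x \<alpha>) - \<alpha> * arctan_primitive (q x \<alpha>)) has_real_derivative
      (v x * arctan (q x \<alpha>) + inverse (1 + (q x \<alpha>)\<^sup>2) * ?q' * u x - \<alpha> * (arctan (q x \<alpha>) * ?q'))) (at x)"
    by (intro DERIV_diff DERIV_mult DERIV_u DERIV_chain2[OF DERIV_arctan] DERIV_chain2[OF DERIV_arctan_primitive]
        q_DERIV_x[OF assms] DERIV_cmult)
  moreover have "\<alpha> * (arctan (q x \<alpha>) * ?q') = arctan (q x \<alpha>) * (v x - v (x - \<alpha>))" using assms by simp
  moreover have "v x * arctan (q x \<alpha>) + inverse (1 + (q x \<alpha>)\<^sup>2) * ?q' * u x - arctan (q x \<alpha>) * (v x - v (x - \<alpha>))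
      = u x * M x \<alpha> + v (x - \<alpha>) * arctan (q x \<alpha>)"
    unfolding M_eq[OF assms] by (simp add: divide_inverse algebra_simps)
  ultimately show ?thesis by simp
qed

lemma DERIV_\<alpha>:
  assumes "\<alpha> \<noteq> 0"
  shows "((\<lambda>\<alpha>. \<alpha> * arctan_primitive (q x \<alpha>)) has_real_derivative
           (v (x - \<alpha>) * arctan (q x \<alpha>) - ln (1 + (q x \<alpha>)\<^sup>2) / 2)) (at \<alpha>)"
proof -
  let ?q' = "(v (x - \<alpha>) - q x \<alpha>) / \<alpha>"
  have "((\<lambda>\<alpha>. \<alpha> * arctan_primitive (q x \<alpha>)) has_real_derivative
      (1 * arctan_primitive (q x \<alpha>) + arctan (q x \<alpha>) * ?q' * \<alpha>)) (at \<alpha>)"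
    by (intro DERIV_mult DERIV_ident DERIV_chain2[OF DERIV_arctan_primitive] q_DERIV_\<alpha>[OF assms])
  moreover have "arctan (q x \<alpha>) * ?q' * \<alpha> = arctan (q x \<alpha>) * (v (x - \<alpha>) - q x \<alpha>)" using assms by simp
  ultimately show ?thesis by (simp add: arctan_primitive_def algebra_simps)
qed

text \<open>Away from $\alpha = 0$ the kernel equals $v(x)/\alpha - \partial_\alpha \arctan q$ plus this function, which is
  $O(|q|/|\alpha|)$. The first term is odd in $\alpha$ and cancels in the principal value, the second
  integrates to boundary terms, and the third is absolutely integrable at infinity.\<close>
definition remainder :: "real \<Rightarrow> real \<Rightarrow> real" where
  "remainder x \<alpha> = - (q x \<alpha> + v x * (q x \<alpha>)\<^sup>2) / (\<alpha> * (1 + (q x \<alpha>)\<^sup>2))"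

lemma DERIV_far:
  assumes "\<alpha> \<noteq> 0"
  shows "((\<lambda>\<alpha>. v x * (ln (\<alpha>\<^sup>2) / 2) - arctan (q x \<alpha>)) has_real_derivative (M x \<alpha> - remainder x \<alpha>)) (at \<alpha>)"
proof -
  have "v x * (2 * \<alpha> / \<alpha>\<^sup>2 / 2) - (v (x - \<alpha>) - q x \<alpha>) / \<alpha> * inverse (1 + (q x \<alpha>)\<^sup>2) = M x \<alpha> - remainder x \<alpha>"
  proof -
    define p where "p = 1 + (q x \<alpha>)\<^sup>2"
    have p: "p \<noteq> 0" unfolding p_def by simp
    have sq: "(q x \<alpha>)\<^sup>2 = p - 1" unfolding p_def by simp
    show ?thesis using assms p unfolding M_eq[OF assms] remainder_def sq
      by (simp add: divide_simps power2_eq_square) (simp add: algebra_simps)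
  qed
  moreover have "((\<lambda>\<alpha>. v x * (ln (\<alpha>\<^sup>2) / 2) - arctan (q x \<alpha>)) has_real_derivative
     v x * (2 * \<alpha> / \<alpha>\<^sup>2 / 2) - inverse (1 + (q x \<alpha>)\<^sup>2) * ((v (x - \<alpha>) - q x \<alpha>) / \<alpha>)) (at \<alpha>)"
  proof (rule DERIV_diff[OF DERIV_cmult DERIV_chain2[OF DERIV_arctan q_DERIV_\<alpha>[OF assms]]])
    have "((\<lambda>\<alpha>. \<alpha>\<^sup>2) has_real_derivative 2 * \<alpha>) (at \<alpha>)" by (auto intro!: derivative_eq_intros)
    then have "((\<lambda>\<alpha>. ln (\<alpha>\<^sup>2) / 2) has_real_derivative inverse (\<alpha>\<^sup>2) * (2 * \<alpha>) / 2) (at \<alpha>)"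
      using assms by (intro DERIV_cdivide DERIV_chain2[OF DERIV_ln]) auto
    then show "((\<lambda>\<alpha>. ln (\<alpha>\<^sup>2) / 2) has_real_derivative 2 * \<alpha> / \<alpha>\<^sup>2 / 2) (at \<alpha>)"
      by (simp add: field_simps)
  qed
  ultimately show ?thesis by (simp add: mult.commute)
qed

lemma v_bound: "\<bar>v x\<bar> \<le> 1 + D" and u_bound: "\<bar>u x\<bar> \<le> 1 + D"
  using has_ac_deriv_bounded[OF vw v_sq w_sq D_nonneg] has_ac_deriv_bounded[OF uv u_sq v_sq D_nonneg] by auto

lemma remainder_bound: "\<bar>remainder x \<alpha>\<bar> \<le> (2 + D) * (\<bar>q x \<alpha>\<bar> / \<bar>\<alpha>\<bar>)"
proof -
  let ?p = "1 + (q x \<alpha>)\<^sup>2"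
  have q2: "(q x \<alpha>)\<^sup>2 \<le> \<bar>q x \<alpha>\<bar> * ?p"
  proof -
    have "(q x \<alpha>)\<^sup>2 * 1 \<le> \<bar>q x \<alpha>\<bar> * (1 + \<bar>q x \<alpha>\<bar> * \<bar>q x \<alpha>\<bar>)"
    proof -
      let ?a = "\<bar>q x \<alpha>\<bar>"
      have "2 * ?a \<le> 1 + ?a * ?a" using zero_le_power2[of "?a - 1"] by (simp add: power2_eq_square algebra_simps)
      then have "?a * ?a \<le> ?a * (1 + ?a * ?a)" by (intro mult_left_mono) auto
      then show ?thesis by (simp add: power2_eq_square)
    qed
    then show ?thesis by (simp add: power2_eq_square)
  qed
  have "\<bar>q x \<alpha> + v x * (q x \<alpha>)\<^sup>2\<bar> \<le> \<bar>q x \<alpha>\<bar> * ?p + (1 + D) * (\<bar>q x \<alpha>\<bar> * ?p)"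
  proof -
    have "\<bar>v x * (q x \<alpha>)\<^sup>2\<bar> \<le> (1 + D) * (\<bar>q x \<alpha>\<bar> * ?p)"
      unfolding abs_mult using q2 v_bound D_nonneg by (intro mult_mono) auto
    moreover have "\<bar>q x \<alpha>\<bar> \<le> \<bar>q x \<alpha>\<bar> * ?p" by (simp add: mult_le_cancel_left1)
    ultimately show ?thesis by linarith
  qed
  also have "\<dots> = (2 + D) * \<bar>q x \<alpha>\<bar> * ?p" by (simp add: algebra_simps)
  finally have "\<bar>q x \<alpha> + v x * (q x \<alpha>)\<^sup>2\<bar> / ?p \<le> (2 + D) * \<bar>q x \<alpha>\<bar>"
    by (simp add: pos_divide_le_eq)
  then have "\<bar>q x \<alpha> + v x * (q x \<alpha>)\<^sup>2\<bar> / ?p / \<bar>\<alpha>\<bar> \<le> (2 + D) * \<bar>q x \<alpha>\<bar> / \<bar>\<alpha>\<bar>"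
    by (rule divide_right_mono) simp
  then show ?thesis unfolding remainder_def minus_divide_left[symmetric] abs_minus_cancel
    by (simp add: abs_divide abs_mult mult.commute)
qed

lemma M_bound: "\<bar>M x \<alpha>\<bar> \<le> \<bar>v x - v (x - \<alpha>)\<bar> / \<bar>\<alpha>\<bar>" if "\<alpha> \<noteq> 0"
proof -
  have "\<bar>M x \<alpha>\<bar> = \<bar>v x - v (x - \<alpha>)\<bar> / \<bar>\<alpha>\<bar> / (1 + (q x \<alpha>)\<^sup>2)"
    unfolding M_eq[OF that] abs_divide by (simp add: abs_of_pos)
  also have "\<dots> \<le> \<bar>v x - v (x - \<alpha>)\<bar> / \<bar>\<alpha>\<bar> / 1"
    by (rule divide_left_mono) auto
  finally show ?thesis by simp
qed

lemma cont_M: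
  shows "\<alpha> \<noteq> 0 \<Longrightarrow> continuous_on UNIV (\<lambda>x. M x \<alpha>)"
    and "0 \<notin> A \<Longrightarrow> continuous_on A (\<lambda>\<alpha>. M x \<alpha>)"
proof -
  assume a: "\<alpha> \<noteq> 0"
  have "continuous_on UNIV (\<lambda>x. (v x - v (x - \<alpha>)) / \<alpha> / (1 + (q x \<alpha>)\<^sup>2))"
    by (intro continuous_intros continuous_on_compose2[OF cont_v] cont_q a) (auto simp: a)
  then show "continuous_on UNIV (\<lambda>x. M x \<alpha>)" using M_eq[OF a] by simp
next
  assume a: "0 \<notin> A"
  have "continuous_on A (\<lambda>\<alpha>. (v x - v (x - \<alpha>)) / \<alpha> / (1 + (q x \<alpha>)\<^sup>2))"
    by (intro continuous_intros continuous_on_compose2[OF cont_v] cont_q a) (use a in auto)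
  then show "continuous_on A (\<lambda>\<alpha>. M x \<alpha>)" 
  proof (rule continuous_on_eq)
    fix \<alpha> assume "\<alpha> \<in> A"
    then have "\<alpha> \<noteq> 0" using a by auto
    then show "(v x - v (x - \<alpha>)) / \<alpha> / (1 + (q x \<alpha>)\<^sup>2) = M x \<alpha>" by (simp add: M_eq)
  qed
qed

lemma measurable_slope [measurable]: "(\<lambda>(x, \<alpha>). q x \<alpha>) \<in> borel_measurable (borel \<Otimes>\<^sub>M borel)"
  unfolding slope_def by measurable

lemma measurable_M [measurable]: "(\<lambda>(x, \<alpha>). M x \<alpha>) \<in> borel_measurable (borel \<Otimes>\<^sub>M borel)"
proof -
  have "deriv u = v" using DERIV_u by (auto intro: DERIV_imp_deriv)
  then show ?thesis unfolding muskat_integrand_def by simp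
qed

end

section \<open>The energy identity on a strip\<close>

lemma integrable_nn_bound:
  fixes k :: "real \<Rightarrow> real"
  assumes "k \<in> borel_measurable borel" "(\<integral>\<^sup>+ x. ennreal \<bar>k x\<bar> \<partial>lborel) \<le> ennreal B"
  shows "integrable lborel k"
  using assms by (intro integrableI_bounded) (auto intro: order.strict_trans1)

lemma abs_le_ends:
  fixes a b \<alpha> :: real
  assumes "\<alpha> \<in> {a..b}" "0 \<notin> {a..b}"
  shows "min \<bar>a\<bar> \<bar>b\<bar> \<le> \<bar>\<alpha>\<bar>" "0 < min \<bar>a\<bar> \<bar>b\<bar>"
  using assms by (auto simp: min_def abs_if)

context H2_profile
begin

lemma sq: 
  assumes "a \<in> {u, v, w}"
  shows "a \<in> borel_measurable borel" "(\<integral>\<^sup>+ x. ennreal ((a x)\<^sup>2) \<partial>lborel) \<le> ennreal D"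
  using assms u_sq v_sq w_sq by auto

text \<open>All quantities to be integrated are dominated by products of two translates of $u$, $v$ or $w$.\<close>
lemma pair_le:
  assumes a: "a \<in> {u, v, w}" and b: "b \<in> {u, v, w}"
  shows "(\<integral>\<^sup>+ x. ennreal (\<bar>a (x - c)\<bar> * \<bar>b (x - d)\<bar>) \<partial>lborel) \<le> ennreal D"
proof -
  have [measurable]: "a \<in> borel_measurable borel" "b \<in> borel_measurable borel" using sq a b by blast+
  have "(\<integral>\<^sup>+ x. ennreal (\<bar>a (x - c)\<bar> * \<bar>b (x - d)\<bar>) \<partial>lborel) = (\<integral>\<^sup>+ x. ennreal (\<bar>a x\<bar> * \<bar>b (x + (c - d))\<bar>) \<partial>lborel)"
    using nn_integral_real_affine[of "\<lambda>x. ennreal (\<bar>a (x - c)\<bar> * \<bar>b (x - d)\<bar>)" 1 c]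
    by (simp add: algebra_simps)
  also have "\<dots> \<le> ennreal D"
    by (rule nn_integral_shift_product_le) (use sq a b D_nonneg in auto)
  finally show ?thesis .
qed

lemma two_pairs_le:
  assumes "a \<in> {u, v, w}" "b \<in> {u, v, w}" "a' \<in> {u, v, w}" "b' \<in> {u, v, w}" "A \<ge> 0"
    and le: "\<And>x. \<bar>k x\<bar> \<le> A * (\<bar>a (x - c)\<bar> * \<bar>b (x - d)\<bar> + \<bar>a' (x - c')\<bar> * \<bar>b' (x - d')\<bar>)"
  shows "(\<integral>\<^sup>+ x. ennreal \<bar>k x\<bar> \<partial>lborel) \<le> ennreal (A * (2 * D))"
proof -
  have [measurable]: "a \<in> borel_measurable borel" "b \<in> borel_measurable borel"
    "a' \<in> borel_measurable borel" "b' \<in> borel_measurable borel" using sq assms(1-4) by blast+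
  have "(\<integral>\<^sup>+ x. ennreal \<bar>k x\<bar> \<partial>lborel) \<le> (\<integral>\<^sup>+ x. ennreal A *
     (ennreal (\<bar>a (x - c)\<bar> * \<bar>b (x - d)\<bar>) + ennreal (\<bar>a' (x - c')\<bar> * \<bar>b' (x - d')\<bar>)) \<partial>lborel)"
  proof (rule nn_integral_mono)
    fix x
    have "ennreal \<bar>k x\<bar> \<le> ennreal (A * (\<bar>a (x - c)\<bar> * \<bar>b (x - d)\<bar> + \<bar>a' (x - c')\<bar> * \<bar>b' (x - d')\<bar>))"
      by (rule ennreal_leI[OF le])
    also have "\<dots> = ennreal A * (ennreal (\<bar>a (x - c)\<bar> * \<bar>b (x - d)\<bar>) + ennreal (\<bar>a' (x - c')\<bar> * \<bar>b' (x - d')\<bar>))"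
      using \<open>A \<ge> 0\<close> by (subst ennreal_mult) auto
    finally show "ennreal \<bar>k x\<bar> \<le> ennreal A * (ennreal (\<bar>a (x - c)\<bar> * \<bar>b (x - d)\<bar>) + ennreal (\<bar>a' (x - c')\<bar> * \<bar>b' (x - d')\<bar>))" .
  qed
  also have "\<dots> = ennreal A * ((\<integral>\<^sup>+ x. ennreal (\<bar>a (x - c)\<bar> * \<bar>b (x - d)\<bar>) \<partial>lborel) + 
       (\<integral>\<^sup>+ x. ennreal (\<bar>a' (x - c')\<bar> * \<bar>b' (x - d')\<bar>) \<partial>lborel))"
    by (subst nn_integral_cmult, simp) (subst nn_integral_add, auto)
  also have "\<dots> \<le> ennreal A * (ennreal D + ennreal D)"
    by (intro mult_left_mono add_mono pair_le assms) auto
  also have "ennreal D + ennreal D = ennreal (2 * D)"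
    unfolding mult_2 by (rule ennreal_plus[symmetric]) (rule D_nonneg)+
  also have "ennreal A * ennreal (2 * D) = ennreal (A * (2 * D))"
    using \<open>A \<ge> 0\<close> by (rule ennreal_mult'[symmetric])
  finally show ?thesis .
qed

lemma kernel_bounds:
  assumes "\<alpha> \<noteq> 0"
  shows uM_le: "(\<integral>\<^sup>+ x. ennreal \<bar>u x * M x \<alpha>\<bar> \<partial>lborel) \<le> ennreal (1 / \<bar>\<alpha>\<bar> * (2 * D))"
    and vA_le: "(\<integral>\<^sup>+ x. ennreal \<bar>v (x - \<alpha>) * arctan (q x \<alpha>)\<bar> \<partial>lborel) \<le> ennreal (1 / \<bar>\<alpha>\<bar> * (2 * D))"
    and uq_le: "(\<integral>\<^sup>+ x. ennreal \<bar>u x * q x \<alpha>\<bar> \<partial>lborel) \<le> ennreal (1 / \<bar>\<alpha>\<bar> * (2 * D))"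
    and qq_le: "(\<integral>\<^sup>+ x. ennreal \<bar>(q x \<alpha>)\<^sup>2\<bar> \<partial>lborel) \<le> ennreal (2 / \<alpha>\<^sup>2 * (2 * D))"
    and ln_le: "(\<integral>\<^sup>+ x. ennreal \<bar>ln (1 + (q x \<alpha>)\<^sup>2)\<bar> \<partial>lborel) \<le> ennreal (2 / \<alpha>\<^sup>2 * (2 * D))"
proof -
  show "(\<integral>\<^sup>+ x. ennreal \<bar>u x * M x \<alpha>\<bar> \<partial>lborel) \<le> ennreal (1 / \<bar>\<alpha>\<bar> * (2 * D))"
  proof (rule two_pairs_le[of u v u v _ _ 0 0 0 \<alpha>])
    fix x
    have "\<bar>M x \<alpha>\<bar> \<le> 1 / \<bar>\<alpha>\<bar> * (\<bar>v x\<bar> + \<bar>v (x - \<alpha>)\<bar>)"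
      by (rule order.trans[OF M_bound[OF assms]]) (auto intro!: divide_right_mono)
    then have "\<bar>u x\<bar> * \<bar>M x \<alpha>\<bar> \<le> \<bar>u x\<bar> * (1 / \<bar>\<alpha>\<bar> * (\<bar>v x\<bar> + \<bar>v (x - \<alpha>)\<bar>))"
      by (rule mult_left_mono) simp
    then show "\<bar>u x * M x \<alpha>\<bar> \<le> 1 / \<bar>\<alpha>\<bar> * (\<bar>u (x - 0)\<bar> * \<bar>v (x - 0)\<bar> + \<bar>u (x - 0)\<bar> * \<bar>v (x - \<alpha>)\<bar>)"
      by (simp add: abs_mult algebra_simps)
  qed auto
  show "(\<integral>\<^sup>+ x. ennreal \<bar>v (x - \<alpha>) * arctan (q x \<alpha>)\<bar> \<partial>lborel) \<le> ennreal (1 / \<bar>\<alpha>\<bar> * (2 * D))"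
  proof (rule two_pairs_le[of v u v u _ _ \<alpha> 0 \<alpha> \<alpha>])
    fix x
    have "\<bar>arctan (q x \<alpha>)\<bar> \<le> 1 / \<bar>\<alpha>\<bar> * (\<bar>u x\<bar> + \<bar>u (x - \<alpha>)\<bar>)"
      by (rule order.trans[OF abs_arctan_le abs_slope_le])
    then have "\<bar>v (x - \<alpha>)\<bar> * \<bar>arctan (q x \<alpha>)\<bar> \<le> \<bar>v (x - \<alpha>)\<bar> * (1 / \<bar>\<alpha>\<bar> * (\<bar>u x\<bar> + \<bar>u (x - \<alpha>)\<bar>))"
      by (rule mult_left_mono) simp
    then show "\<bar>v (x - \<alpha>) * arctan (q x \<alpha>)\<bar> \<le> 1 / \<bar>\<alpha>\<bar> * (\<bar>v (x - \<alpha>)\<bar> * \<bar>u (x - 0)\<bar> + \<bar>v (x - \<alpha>)\<bar> * \<bar>u (x - \<alpha>)\<bar>)"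
      by (simp add: abs_mult algebra_simps)
  qed auto
  show "(\<integral>\<^sup>+ x. ennreal \<bar>u x * q x \<alpha>\<bar> \<partial>lborel) \<le> ennreal (1 / \<bar>\<alpha>\<bar> * (2 * D))"
  proof (rule two_pairs_le[of u u u u _ _ 0 0 0 \<alpha>])
    fix x
    have "\<bar>u x\<bar> * \<bar>q x \<alpha>\<bar> \<le> \<bar>u x\<bar> * (1 / \<bar>\<alpha>\<bar> * (\<bar>u x\<bar> + \<bar>u (x - \<alpha>)\<bar>))"
      by (rule mult_left_mono[OF abs_slope_le]) simp
    then show "\<bar>u x * q x \<alpha>\<bar> \<le> 1 / \<bar>\<alpha>\<bar> * (\<bar>u (x - 0)\<bar> * \<bar>u (x - 0)\<bar> + \<bar>u (x - 0)\<bar> * \<bar>u (x - \<alpha>)\<bar>)"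
      by (simp add: abs_mult algebra_simps)
  qed auto
  show qq: "(\<integral>\<^sup>+ x. ennreal \<bar>(q x \<alpha>)\<^sup>2\<bar> \<partial>lborel) \<le> ennreal (2 / \<alpha>\<^sup>2 * (2 * D))"
    by (rule two_pairs_le[of u u u u _ _ 0 0 \<alpha> \<alpha>]) (use slope_square_le[of u _ \<alpha>] in auto)
  show "(\<integral>\<^sup>+ x. ennreal \<bar>ln (1 + (q x \<alpha>)\<^sup>2)\<bar> \<partial>lborel) \<le> ennreal (2 / \<alpha>\<^sup>2 * (2 * D))"
    by (rule order.trans[OF nn_integral_mono qq]) 
       (use ln_one_plus_square_bounds in \<open>auto intro!: ennreal_leI\<close>)
qed

lemma uM_integral:
  assumes "\<alpha> \<noteq> 0"
  shows "(LBINT x. u x * M x \<alpha>) = - (LBINT x. v (x - \<alpha>) * arctan (q x \<alpha>))"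
proof -
  have [measurable]: "(\<lambda>x. q x \<alpha>) \<in> borel_measurable borel" "(\<lambda>x. M x \<alpha>) \<in> borel_measurable borel"
    by measurable
  have [measurable]: "arctan_primitive \<in> borel_measurable borel"
    unfolding arctan_primitive_def[abs_def] by measurable
  have i: "integrable lborel (\<lambda>x. u x * M x \<alpha>)" "integrable lborel (\<lambda>x. v (x - \<alpha>) * arctan (q x \<alpha>))"
     "integrable lborel (\<lambda>x. u x * q x \<alpha>)" "integrable lborel (\<lambda>x. (q x \<alpha>)\<^sup>2)"
    by (rule integrable_nn_bound[rotated], rule kernel_bounds[OF assms], measurable)+
  have "integrable lborel (\<lambda>x. u x * arctan (q x \<alpha>))"
    by (rule Bochner_Integration.integrable_bound[OF i(3)])
       (auto simp: abs_mult intro!: mult_left_mono abs_arctan_le)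
  moreover have "integrable lborel (\<lambda>x. arctan_primitive (q x \<alpha>))"
    by (rule Bochner_Integration.integrable_bound[OF i(4)]) (auto simp: abs_arctan_primitive_le)
  ultimately have "(LBINT x. u x * M x \<alpha> + v (x - \<alpha>) * arctan (q x \<alpha>)) = 0"
    using i by (intro integral_derivative_zero[OF DERIV_x[OF assms]])
       (auto intro!: continuous_intros continuous_on_compose2[OF cont_v] cont_u cont_M cont_q assms)
  then show ?thesis using i by simp
qed

text \<open>On a strip $a \le \alpha \le b$ that avoids $\alpha = 0$ everything is absolutely integrable. Integrate
  the $x$-derivative above over $x$, the $\alpha$-derivative over $\alpha$, and eliminate the common term
  $v(x-\alpha)\arctan q$: what remains is the logarithm and the values of $G$ on the two edges.\<close>
lemma strip_identity:
  assumes "a \<le> b" "0 \<notin> {a..b}"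
  shows "integrable lborel (\<lambda>x. u x * (LBINT \<alpha>:{a..b}. M x \<alpha>))" (is ?i)
    and "(LBINT x. u x * (LBINT \<alpha>:{a..b}. M x \<alpha>)) =
       - (LBINT \<alpha>:{a..b}. LBINT x. ln (1 + (q x \<alpha>)\<^sup>2)) / 2
       - (LBINT x. b * arctan_primitive (q x b) - a * arctan_primitive (q x a))" (is ?e)
proof -
  have nz: "\<alpha> \<noteq> 0" if "\<alpha> \<in> {a..b}" for \<alpha> using that assms by auto
  define m where "m = min \<bar>a\<bar> \<bar>b\<bar>"
  have m: "m > 0" using abs_le_ends(2)[of a a b] assms unfolding m_def by auto
  have le1: "ennreal (1 / \<bar>\<alpha>\<bar> * (2 * D)) \<le> ennreal (1 / m * (2 * D))"
    and le2: "ennreal (2 / \<alpha>\<^sup>2 * (2 * D)) \<le> ennreal (2 / m\<^sup>2 * (2 * D))" if "\<alpha> \<in> {a..b}" for \<alpha>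
  proof -
    have ma: "m \<le> \<bar>\<alpha>\<bar>" using abs_le_ends(1)[OF that assms(2)] unfolding m_def .
    then have "m\<^sup>2 \<le> \<bar>\<alpha>\<bar>\<^sup>2" using m by (intro power_mono) auto
    then show "ennreal (1 / \<bar>\<alpha>\<bar> * (2 * D)) \<le> ennreal (1 / m * (2 * D))"
      and "ennreal (2 / \<alpha>\<^sup>2 * (2 * D)) \<le> ennreal (2 / m\<^sup>2 * (2 * D))"
      using ma m D_nonneg by (auto intro!: ennreal_leI mult_right_mono divide_left_mono)
  qed
  have I1: "integrable (lborel \<Otimes>\<^sub>M lborel) (\<lambda>(x, \<alpha>). indicator {a..b} \<alpha> * (u x * M x \<alpha>))"
    by (rule integrable_strip, measurable) (rule order.trans[OF uM_le[OF nz] le1])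
  have I2: "integrable (lborel \<Otimes>\<^sub>M lborel) (\<lambda>(x, \<alpha>). indicator {a..b} \<alpha> * (v (x - \<alpha>) * arctan (q x \<alpha>)))"
    by (rule integrable_strip, measurable) (rule order.trans[OF vA_le[OF nz] le1])
  have I3: "integrable (lborel \<Otimes>\<^sub>M lborel) (\<lambda>(x, \<alpha>). indicator {a..b} \<alpha> * ln (1 + (q x \<alpha>)\<^sup>2))"
    by (rule integrable_strip, measurable) (rule order.trans[OF ln_le[OF nz] le2])
  have c: "u x * (LBINT \<alpha>:{a..b}. M x \<alpha>) = (LBINT \<alpha>. indicator {a..b} \<alpha> * (u x * M x \<alpha>))" for x
    unfolding set_lebesgue_integral_def by (simp add: mult.left_commute)
  show ?i unfolding c using lborel_pair.integrable_fst'[OF I1] by simp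
  have inner: "(LBINT \<alpha>. indicator {a..b} \<alpha> * (v (x - \<alpha>) * arctan (q x \<alpha>))) =
     (b * arctan_primitive (q x b) - a * arctan_primitive (q x a)) + (LBINT \<alpha>. indicator {a..b} \<alpha> * ln (1 + (q x \<alpha>)\<^sup>2)) / 2" for x
  proof -
    have c1: "continuous_on {a..b} (\<lambda>\<alpha>. v (x - \<alpha>) * arctan (q x \<alpha>))"
      and c2: "continuous_on {a..b} (\<lambda>\<alpha>. ln (1 + (q x \<alpha>)\<^sup>2))"
      by (intro continuous_intros continuous_on_compose2[OF cont_v] cont_q assms; auto)+
    have s1: "integrable lborel (\<lambda>\<alpha>. indicator {a..b} \<alpha> *\<^sub>R (v (x - \<alpha>) * arctan (q x \<alpha>)))"
      and s2: "integrable lborel (\<lambda>\<alpha>. indicator {a..b} \<alpha> *\<^sub>R ln (1 + (q x \<alpha>)\<^sup>2))"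
      using borel_integrable_atLeastAtMost'[OF c1] borel_integrable_atLeastAtMost'[OF c2]
      unfolding set_integrable_def by auto
    have "(LBINT \<alpha>. indicator {a..b} \<alpha> *\<^sub>R (v (x - \<alpha>) * arctan (q x \<alpha>) - ln (1 + (q x \<alpha>)\<^sup>2) / 2)) =
      b * arctan_primitive (q x b) - a * arctan_primitive (q x a)"
    proof (rule integral_FTC_Icc[OF assms(1)])
      fix \<alpha> assume "a \<le> \<alpha>" "\<alpha> \<le> b"
      then show "((\<lambda>\<alpha>. \<alpha> * arctan_primitive (q x \<alpha>)) has_vector_derivative 
           v (x - \<alpha>) * arctan (q x \<alpha>) - ln (1 + (q x \<alpha>)\<^sup>2) / 2) (at \<alpha> within {a..b})"
        using DERIV_\<alpha>[OF nz, of \<alpha> x]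
        by (simp add: has_real_derivative_iff_has_vector_derivative has_vector_derivative_at_within)
    qed (intro continuous_intros c1 c2, auto)
    moreover have "(LBINT \<alpha>. indicator {a..b} \<alpha> *\<^sub>R (v (x - \<alpha>) * arctan (q x \<alpha>) - ln (1 + (q x \<alpha>)\<^sup>2) / 2))
       = (LBINT \<alpha>. indicator {a..b} \<alpha> *\<^sub>R (v (x - \<alpha>) * arctan (q x \<alpha>)) - (indicator {a..b} \<alpha> *\<^sub>R ln (1 + (q x \<alpha>)\<^sup>2)) / 2)"
      by (intro Bochner_Integration.integral_cong) (auto simp: algebra_simps)
    ultimately show ?thesis using s1 s2 by simp
  qed
  have J2: "integrable lborel (\<lambda>x. LBINT \<alpha>. indicator {a..b} \<alpha> * (v (x - \<alpha>) * arctan (q x \<alpha>)))"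
    and J3: "integrable lborel (\<lambda>x. LBINT \<alpha>. indicator {a..b} \<alpha> * ln (1 + (q x \<alpha>)\<^sup>2))"
    using lborel_pair.integrable_fst'[OF I2] lborel_pair.integrable_fst'[OF I3] by auto
  have JB: "integrable lborel (\<lambda>x. b * arctan_primitive (q x b) - a * arctan_primitive (q x a))"
    using Bochner_Integration.integrable_diff[OF J2 integrable_divide[OF J3, of 2]] unfolding inner by simp
  have "(LBINT x. u x * (LBINT \<alpha>:{a..b}. M x \<alpha>)) = (LBINT \<alpha>. LBINT x. indicator {a..b} \<alpha> * (u x * M x \<alpha>))"
    unfolding c by (rule lborel_pair.Fubini_integral[OF I1, symmetric])
  also have "\<dots> = (LBINT \<alpha>. - (LBINT x. indicator {a..b} \<alpha> * (v (x - \<alpha>) * arctan (q x \<alpha>))))"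
    by (intro Bochner_Integration.integral_cong) (auto simp: indicator_def uM_integral nz)
  also have "\<dots> = - (LBINT x. LBINT \<alpha>. indicator {a..b} \<alpha> * (v (x - \<alpha>) * arctan (q x \<alpha>)))"
    using lborel_pair.Fubini_integral[OF I2] by simp
  also have "\<dots> = - (LBINT x. b * arctan_primitive (q x b) - a * arctan_primitive (q x a))
        - (LBINT x. LBINT \<alpha>. indicator {a..b} \<alpha> * ln (1 + (q x \<alpha>)\<^sup>2)) / 2"
    unfolding inner using JB J3 by simp
  also have "(LBINT x. LBINT \<alpha>. indicator {a..b} \<alpha> * ln (1 + (q x \<alpha>)\<^sup>2)) = (LBINT \<alpha>:{a..b}. LBINT x. ln (1 + (q x \<alpha>)\<^sup>2))"
    unfolding set_lebesgue_integral_def using lborel_pair.Fubini_integral[OF I3] by simp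
  finally show ?e by simp
qed

end

section \<open>An integrable majorant for the truncated integrals\<close>

lemma abs_set_integral_le:
  fixes f :: "real \<Rightarrow> real"
  assumes "set_integrable lborel A f"
  shows "ennreal \<bar>LBINT x:A. f x\<bar> \<le> (\<integral>\<^sup>+ x\<in>A. ennreal \<bar>f x\<bar> \<partial>lborel)"
proof -
  have "ennreal \<bar>LBINT x:A. f x\<bar> \<le> (\<integral>\<^sup>+ x. ennreal (norm (indicator A x *\<^sub>R f x)) \<partial>lborel)"
    unfolding set_lebesgue_integral_def
    using integral_norm_bound_ennreal[OF assms[unfolded set_integrable_def]] by simp
  also have "\<dots> = (\<integral>\<^sup>+ x\<in>A. ennreal \<bar>f x\<bar> \<partial>lborel)"
    by (intro nn_integral_cong) (auto simp: indicator_def)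
  finally show ?thesis .
qed

lemma set_integral_combine:
  fixes f :: "real \<Rightarrow> real"
  assumes "a \<le> c" "c \<le> b" "set_integrable lborel {a..b} f"
  shows "(LBINT x:{a..b}. f x) = (LBINT x:{a..c}. f x) + (LBINT x:{c..b}. f x)"
proof -
  have "set_integrable lborel {a..c} f" "set_integrable lborel {c..b} f"
    by (rule set_integrable_subset[OF assms(3)]; use assms in auto)+
  then show ?thesis
    using assms Henstock_Kurzweil_Integration.integral_combine[OF assms(1,2), of f] by (simp add: set_borel_integral_eq_integral)
qed

lemma nn_integral_inverse_square:
  "(\<integral>\<^sup>+ x\<in>{x. 1 \<le> \<bar>x\<bar>}. ennreal (1 / x\<^sup>2) \<partial>lborel) \<le> ennreal 2"
proof -
  have 1: "(\<integral>\<^sup>+ x. ennreal (1 / x\<^sup>2) * indicator {1::real..} x \<partial>lborel) = 1"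
  proof -
    have "(\<integral>\<^sup>+ x. ennreal (1 / x\<^sup>2) * indicator {1::real..} x \<partial>lborel) = ennreal (0 - (\<lambda>x::real. - 1 / x) 1)"
    proof (rule nn_integral_FTC_atLeast[where F = "\<lambda>x. - 1 / x" and T = 0])
      fix x :: real assume "1 \<le> x"
      then show "((\<lambda>x. - 1 / x) has_real_derivative 1 / x\<^sup>2) (at x)"
        by (auto intro!: derivative_eq_intros simp: power2_eq_square)
    next
      show "((\<lambda>x::real. - 1 / x) \<longlongrightarrow> 0) at_top"
        by (intro tendsto_divide_0[OF tendsto_const] filterlim_at_top_imp_at_infinity filterlim_ident)
    qed auto
    then show ?thesis by simp
  qed
  have 2: "(\<integral>\<^sup>+ x. ennreal (1 / x\<^sup>2) * indicator {..-1} x \<partial>lborel) = (\<integral>\<^sup>+ x. ennreal (1 / x\<^sup>2) * indicator {1..} x \<partial>lborel)"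
    by (subst nn_integral_real_affine[of _ "-1" 0]) (auto intro!: nn_integral_cong simp: indicator_def)
  have "(\<integral>\<^sup>+ x\<in>{x. 1 \<le> \<bar>x\<bar>}. ennreal (1 / x\<^sup>2) \<partial>lborel)
     \<le> (\<integral>\<^sup>+ x. ennreal (1 / x\<^sup>2) * indicator {1..} x + ennreal (1 / x\<^sup>2) * indicator {..-1::real} x \<partial>lborel)"
    by (intro nn_integral_mono) (auto simp: indicator_def abs_if split: if_splits)
  also have "\<dots> = ennreal 1 + ennreal 1" by (subst nn_integral_add) (auto simp: 1 2)
  also have "\<dots> = ennreal 2" by (subst ennreal_plus[symmetric]) auto
  finally show ?thesis .
qed

context H2_profile
begin

definition truncated :: "real \<Rightarrow> real \<Rightarrow> real" where
  "truncated \<epsilon> x = (LBINT \<alpha>:{\<alpha>. \<epsilon> < \<bar>\<alpha>\<bar> \<and> \<bar>\<alpha>\<bar> < 1 / \<epsilon>}. M x \<alpha>)"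

text \<open>The boundary terms produced at $|\alpha| = 1/\epsilon$ by integrating $-\partial_\alpha \arctan q$. Added
  to the truncated integral they cancel its boundary terms at infinity, so that the majorant is independent of
  $\epsilon$; their own pairing with $u$ is $O(\epsilon)$.\<close>
definition end_terms :: "real \<Rightarrow> real \<Rightarrow> real" where
  "end_terms \<epsilon> x = arctan (q x (1 / \<epsilon>)) - arctan (q x (- (1 / \<epsilon>)))"

text \<open>Dominates the part $|\alpha| \le 1$, where $|M| \le |v(x) - v(x-\alpha)|/|\alpha|$ and the second derivative enters.\<close>
definition near :: "real \<Rightarrow> ennreal" where
  "near x = (\<integral>\<^sup>+ \<alpha>\<in>{-1..1}. (\<integral>\<^sup>+ r\<in>{0..1}. ennreal \<bar>w (x - r * \<alpha>)\<bar> \<partial>lborel) \<partial>lborel)"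

text \<open>Dominates, up to the factor $2 + D$, the integral of the remainder kernel over $|\alpha| \ge 1$.\<close>
definition far :: "real \<Rightarrow> ennreal" where
  "far x = (\<integral>\<^sup>+ \<alpha>\<in>{\<alpha>. 1 \<le> \<bar>\<alpha>\<bar>}. ennreal (1 / \<bar>\<alpha>\<bar>) * ennreal \<bar>q x \<alpha>\<bar> \<partial>lborel)"

definition majorant :: "real \<Rightarrow> ennreal" where
  "majorant x = near x + (ennreal \<bar>q x 1\<bar> + ennreal \<bar>q x (-1)\<bar>) + ennreal (2 + D) * far x"

lemma M_integrable: "0 \<notin> {a..b} \<Longrightarrow> set_integrable lborel {a..b} (M x)"
  by (rule borel_integrable_atLeastAtMost') (rule cont_M)

lemma cont_remainder: "0 \<notin> A \<Longrightarrow> continuous_on A (\<lambda>\<alpha>. remainder x \<alpha>)"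
  unfolding remainder_def by (intro continuous_intros cont_q) auto

lemma remainder_integrable: "0 \<notin> {a..b} \<Longrightarrow> set_integrable lborel {a..b} (remainder x)"
  by (rule borel_integrable_atLeastAtMost') (rule cont_remainder)

lemma truncated_split:
  assumes "0 < \<epsilon>" "\<epsilon> < 1"
  shows "truncated \<epsilon> x = (LBINT \<alpha>:{\<epsilon>..1/\<epsilon>}. M x \<alpha>) + (LBINT \<alpha>:{-(1/\<epsilon>)..-\<epsilon>}. M x \<alpha>)"
proof -
  have lt: "\<epsilon> < 1 / \<epsilon>" using assms by (simp add: less_divide_eq) (metis mult_strict_mono' less_eq_real_def mult_1)
  have i: "set_integrable lborel {\<epsilon>..1/\<epsilon>} (M x)" "set_integrable lborel {-(1/\<epsilon>)..-\<epsilon>} (M x)"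
    using assms by (auto intro!: M_integrable)
  have "truncated \<epsilon> x = (LBINT \<alpha>. indicator {\<epsilon>..1/\<epsilon>} \<alpha> *\<^sub>R M x \<alpha> + indicator {-(1/\<epsilon>)..-\<epsilon>} \<alpha> *\<^sub>R M x \<alpha>)"
    unfolding truncated_def set_lebesgue_integral_def
  proof (rule integral_cong_AE)
    have "AE \<alpha> in lborel. \<alpha> \<noteq> \<epsilon> \<and> \<alpha> \<noteq> -\<epsilon> \<and> \<alpha> \<noteq> 1/\<epsilon> \<and> \<alpha> \<noteq> -(1/\<epsilon>)"
      by (intro AE_conjI AE_lborel_singleton)
    then show "AE \<alpha> in lborel. indicator {\<alpha>. \<epsilon> < \<bar>\<alpha>\<bar> \<and> \<bar>\<alpha>\<bar> < 1 / \<epsilon>} \<alpha> *\<^sub>R M x \<alpha> =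
       indicator {\<epsilon>..1/\<epsilon>} \<alpha> *\<^sub>R M x \<alpha> + indicator {-(1/\<epsilon>)..-\<epsilon>} \<alpha> *\<^sub>R M x \<alpha>"
    proof eventually_elim
      case (elim \<alpha>)
      consider "\<alpha> > 0" | "\<alpha> \<le> 0" by linarith
      then show ?case
      proof cases
        case 1
        then have "\<alpha> \<notin> {-(1/\<epsilon>)..-\<epsilon>}" using assms by auto
        then show ?thesis using elim 1 by (auto simp: indicator_def)
      next
        case 2
        then have "\<alpha> \<notin> {\<epsilon>..1/\<epsilon>}" using assms by auto
        then show ?thesis using elim 2 by (auto simp: indicator_def)
      qed
    qed
  qed measurable
  then show ?thesis using i unfolding set_lebesgue_integral_def set_integrable_def by simp
qed

lemma M_far:
  assumes "a \<le> b" "0 \<notin> {a..b}"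
  shows "(LBINT \<alpha>:{a..b}. M x \<alpha>) = v x * (ln (b\<^sup>2) / 2 - ln (a\<^sup>2) / 2) - (arctan (q x b) - arctan (q x a)) + (LBINT \<alpha>:{a..b}. remainder x \<alpha>)"
proof -
  have "(LBINT \<alpha>. indicator {a..b} \<alpha> *\<^sub>R (M x \<alpha> - remainder x \<alpha>)) =
     (v x * (ln (b\<^sup>2) / 2) - arctan (q x b)) - (v x * (ln (a\<^sup>2) / 2) - arctan (q x a))"
  proof (rule integral_FTC_Icc[OF assms(1)])
    fix \<alpha> assume "a \<le> \<alpha>" "\<alpha> \<le> b"
    then have "\<alpha> \<noteq> 0" using assms by auto
    from DERIV_far[OF this, of x]
    show "((\<lambda>\<alpha>. v x * (ln (\<alpha>\<^sup>2) / 2) - arctan (q x \<alpha>)) has_vector_derivative M x \<alpha> - remainder x \<alpha>) (at \<alpha> within {a..b})"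
      by (simp add: has_real_derivative_iff_has_vector_derivative has_vector_derivative_at_within)
  qed (intro continuous_intros cont_M cont_remainder assms)
  moreover have "(LBINT \<alpha>. indicator {a..b} \<alpha> *\<^sub>R (M x \<alpha> - remainder x \<alpha>)) = (LBINT \<alpha>:{a..b}. M x \<alpha>) - (LBINT \<alpha>:{a..b}. remainder x \<alpha>)"
    using set_integral_diff(2)[OF M_integrable[OF assms(2)] remainder_integrable[OF assms(2)]]
    by (simp add: set_lebesgue_integral_def)
  ultimately show ?thesis by (simp add: algebra_simps)
qed

lemma abs_two_le:
  fixes f :: "real \<Rightarrow> real" and g :: "real \<Rightarrow> ennreal"
  assumes f: "set_integrable lborel A f" "set_integrable lborel B f" and disj: "A \<inter> B = {}" "A \<union> B \<subseteq> C"
    and le: "\<And>x. x \<in> A \<union> B \<Longrightarrow> ennreal \<bar>f x\<bar> \<le> g x" and [measurable]: "A \<in> sets borel" "B \<in> sets borel" "f \<in> borel_measurable borel"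
  shows "ennreal \<bar>(LBINT x:A. f x) + (LBINT x:B. f x)\<bar> \<le> (\<integral>\<^sup>+ x\<in>C. g x \<partial>lborel)"
proof -
  have "ennreal \<bar>(LBINT x:A. f x) + (LBINT x:B. f x)\<bar> \<le> ennreal (\<bar>LBINT x:A. f x\<bar> + \<bar>LBINT x:B. f x\<bar>)"
    by (intro ennreal_leI) auto
  also have "\<dots> = ennreal \<bar>LBINT x:A. f x\<bar> + ennreal \<bar>LBINT x:B. f x\<bar>" by simp
  also have "\<dots> \<le> (\<integral>\<^sup>+ x\<in>A. ennreal \<bar>f x\<bar> \<partial>lborel) + (\<integral>\<^sup>+ x\<in>B. ennreal \<bar>f x\<bar> \<partial>lborel)"
    by (intro add_mono abs_set_integral_le f)
  also have "\<dots> = (\<integral>\<^sup>+ x. ennreal \<bar>f x\<bar> * indicator A x + ennreal \<bar>f x\<bar> * indicator B x \<partial>lborel)"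
    by (rule nn_integral_add[symmetric]) auto
  also have "\<dots> \<le> (\<integral>\<^sup>+ x\<in>C. g x \<partial>lborel)"
  proof (rule nn_integral_mono)
    fix x show "ennreal \<bar>f x\<bar> * indicator A x + ennreal \<bar>f x\<bar> * indicator B x \<le> g x * indicator C x"
      using disj le[of x] by (cases "x \<in> A"; cases "x \<in> B") auto
  qed
  finally show ?thesis .
qed

lemma measurable_M1 [measurable]: "M x \<in> borel_measurable borel"
  using measurable_compose_Pair1[OF _ measurable_M, of x] by simp

lemma measurable_remainder [measurable]: "remainder x \<in> borel_measurable borel"
  unfolding remainder_def[abs_def] slope_def by measurable

text \<open>Cut at $|\alpha| = 1$. Outside, the contributions of $v(x)/\alpha$ are $v(x) \ln R$ and $-v(x) \ln R$ with $R = 1/\epsilon$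
  and cancel; the boundary terms at $R$ are compensated by the added ones, and those at $1$
  stay in the majorant.\<close>
lemma truncated_le_majorant:
  assumes "0 < \<epsilon>" "\<epsilon> < 1"
  shows "ennreal \<bar>truncated \<epsilon> x + end_terms \<epsilon> x\<bar> \<le> majorant x"
proof -
  define R where "R = 1 / \<epsilon>"
  have R: "R > 1" using assms by (simp add: R_def)
  have z: "0 \<notin> {\<epsilon>..R}" "0 \<notin> {-R..-\<epsilon>}" "0 \<notin> {1..R}" "0 \<notin> {-R..-1}" "0 \<notin> {\<epsilon>..1}" "0 \<notin> {-1..-\<epsilon>}"
    using assms R by auto
  let ?near = "(LBINT \<alpha>:{\<epsilon>..1}. M x \<alpha>) + (LBINT \<alpha>:{-1..-\<epsilon>}. M x \<alpha>)"
  let ?mid = "arctan (q x 1) - arctan (q x (-1))"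
  let ?far = "(LBINT \<alpha>:{1..R}. remainder x \<alpha>) + (LBINT \<alpha>:{-R..-1}. remainder x \<alpha>)"
  have "truncated \<epsilon> x + end_terms \<epsilon> x = ?near + ?mid + ?far"
  proof -
    have "(LBINT \<alpha>:{\<epsilon>..R}. M x \<alpha>) = (LBINT \<alpha>:{\<epsilon>..1}. M x \<alpha>) + (LBINT \<alpha>:{1..R}. M x \<alpha>)"
      by (rule set_integral_combine) (use assms R M_integrable z in auto)
    moreover have "(LBINT \<alpha>:{-R..-\<epsilon>}. M x \<alpha>) = (LBINT \<alpha>:{-R..-1}. M x \<alpha>) + (LBINT \<alpha>:{-1..-\<epsilon>}. M x \<alpha>)"
      by (rule set_integral_combine) (use assms R M_integrable z in auto)
    ultimately show ?thesis
      using M_far[OF _ z(3), of x] M_far[OF _ z(4), of x] R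
      unfolding truncated_split[OF assms] end_terms_def R_def[symmetric] by (simp add: algebra_simps)
  qed
  then have "ennreal \<bar>truncated \<epsilon> x + end_terms \<epsilon> x\<bar> \<le> ennreal (\<bar>?near\<bar> + (\<bar>q x 1\<bar> + \<bar>q x (-1)\<bar>) + \<bar>?far\<bar>)"
    using abs_arctan_le[of "q x 1"] abs_arctan_le[of "q x (-1)"] by (intro ennreal_leI) linarith
  also have "\<dots> = ennreal \<bar>?near\<bar> + (ennreal \<bar>q x 1\<bar> + ennreal \<bar>q x (-1)\<bar>) + ennreal \<bar>?far\<bar>"
    by simp
  also have "\<dots> \<le> majorant x"
    unfolding majorant_def
  proof (intro add_mono order.refl)
    show "ennreal \<bar>?near\<bar> \<le> near x"
      unfolding near_def
    proof (rule abs_two_le)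
      fix \<alpha> assume "\<alpha> \<in> {\<epsilon>..1} \<union> {-1..-\<epsilon>}"
      then have "\<alpha> \<noteq> 0" using z(5,6) by blast
      then show "ennreal \<bar>M x \<alpha>\<bar> \<le> (\<integral>\<^sup>+ r\<in>{0..1}. ennreal \<bar>w (x - r * \<alpha>)\<bar> \<partial>lborel)"
        by (intro order.trans[OF ennreal_leI[OF M_bound] has_ac_deriv_diff_le_scaled[OF vw]])
    qed (use assms R M_integrable z in auto)
    have "ennreal \<bar>?far\<bar> \<le> (\<integral>\<^sup>+ \<alpha>\<in>{\<alpha>. 1 \<le> \<bar>\<alpha>\<bar>}. ennreal (2 + D) * (ennreal (1 / \<bar>\<alpha>\<bar>) * ennreal \<bar>q x \<alpha>\<bar>) \<partial>lborel)"
    proof (rule abs_two_le)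
      fix \<alpha>
      have "ennreal \<bar>remainder x \<alpha>\<bar> \<le> ennreal ((2 + D) * ((1 / \<bar>\<alpha>\<bar>) * \<bar>q x \<alpha>\<bar>))"
        using remainder_bound[of x \<alpha>] by (intro ennreal_leI) simp
      also have "\<dots> = ennreal (2 + D) * (ennreal (1 / \<bar>\<alpha>\<bar>) * ennreal \<bar>q x \<alpha>\<bar>)"
        by (subst ennreal_mult', use D_nonneg in simp, subst ennreal_mult', simp, rule refl)
      finally show "ennreal \<bar>remainder x \<alpha>\<bar> \<le> ennreal (2 + D) * (ennreal (1 / \<bar>\<alpha>\<bar>) * ennreal \<bar>q x \<alpha>\<bar>)" .
    qed (use assms R remainder_integrable z in auto)
    also have "\<dots> = ennreal (2 + D) * far x"
      unfolding far_def mult.assoc slope_def by (rule nn_integral_cmult) measurable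
    finally show "ennreal \<bar>?far\<bar> \<le> ennreal (2 + D) * far x" .
  qed
  finally show ?thesis .
qed

lemma measurable_q1 [measurable]: "(\<lambda>x. q x \<alpha>) \<in> borel_measurable borel"
  unfolding slope_def by measurable

lemma measurable_majorant [measurable]: "near \<in> borel_measurable borel" "far \<in> borel_measurable borel" "majorant \<in> borel_measurable borel"
proof -
  show [measurable]: "near \<in> borel_measurable borel" unfolding near_def[abs_def] by measurable
  show [measurable]: "far \<in> borel_measurable borel" unfolding far_def[abs_def] slope_def by measurable
  show "majorant \<in> borel_measurable borel" unfolding majorant_def[abs_def] by measurable
qed

definition majorant_bound :: real where "majorant_bound = 6 * D + (2 + D) * (4 * D)"

lemma near_le: "(\<integral>\<^sup>+ x. ennreal \<bar>u x\<bar> * near x \<partial>lborel) \<le> ennreal (2 * D)"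
proof -
  have "(\<integral>\<^sup>+ x. ennreal \<bar>u x\<bar> * near x \<partial>lborel) = 
     (\<integral>\<^sup>+ x. \<integral>\<^sup>+ \<alpha>. indicator {-1..1} \<alpha> * (\<integral>\<^sup>+ r. indicator {0..1} r * ennreal (\<bar>u x\<bar> * \<bar>w (x - r * \<alpha>)\<bar>) \<partial>lborel) \<partial>lborel \<partial>lborel)"
    unfolding near_def
    by (simp add: nn_integral_cmult[symmetric] nn_integral_multc[symmetric] ennreal_mult' mult_ac)
  also have "\<dots> = (\<integral>\<^sup>+ \<alpha>. \<integral>\<^sup>+ x. indicator {-1..1} \<alpha> * (\<integral>\<^sup>+ r. indicator {0..1} r * ennreal (\<bar>u x\<bar> * \<bar>w (x - r * \<alpha>)\<bar>) \<partial>lborel) \<partial>lborel \<partial>lborel)"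
    by (rule lborel_pair.Fubini') measurable
  also have "\<dots> = (\<integral>\<^sup>+ \<alpha>. indicator {-1..1} \<alpha> * (\<integral>\<^sup>+ x. \<integral>\<^sup>+ r. indicator {0..1} r * ennreal (\<bar>u x\<bar> * \<bar>w (x - r * \<alpha>)\<bar>) \<partial>lborel \<partial>lborel) \<partial>lborel)"
    by (intro nn_integral_cong nn_integral_cmult) measurable
  also have "\<dots> = (\<integral>\<^sup>+ \<alpha>. indicator {-1..1} \<alpha> * (\<integral>\<^sup>+ r. indicator {0..1} r * (\<integral>\<^sup>+ x. ennreal (\<bar>u x\<bar> * \<bar>w (x - r * \<alpha>)\<bar>) \<partial>lborel) \<partial>lborel) \<partial>lborel)"
  proof (rule nn_integral_cong)
    fix \<alpha>
    have "(\<integral>\<^sup>+ x. \<integral>\<^sup>+ r. indicator {0..1} r * ennreal (\<bar>u x\<bar> * \<bar>w (x - r * \<alpha>)\<bar>) \<partial>lborel \<partial>lborel) = 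
      (\<integral>\<^sup>+ r. \<integral>\<^sup>+ x. indicator {0..1} r * ennreal (\<bar>u x\<bar> * \<bar>w (x - r * \<alpha>)\<bar>) \<partial>lborel \<partial>lborel)"
      by (rule lborel_pair.Fubini') measurable
    also have "\<dots> = (\<integral>\<^sup>+ r. indicator {0..1} r * (\<integral>\<^sup>+ x. ennreal (\<bar>u x\<bar> * \<bar>w (x - r * \<alpha>)\<bar>) \<partial>lborel) \<partial>lborel)"
      by (intro nn_integral_cong nn_integral_cmult) measurable
    finally show "indicator {-1..1} \<alpha> * (\<integral>\<^sup>+ x. \<integral>\<^sup>+ r. indicator {0..1} r * ennreal (\<bar>u x\<bar> * \<bar>w (x - r * \<alpha>)\<bar>) \<partial>lborel \<partial>lborel) = 
      indicator {-1..1} \<alpha> * (\<integral>\<^sup>+ r. indicator {0..1} r * (\<integral>\<^sup>+ x. ennreal (\<bar>u x\<bar> * \<bar>w (x - r * \<alpha>)\<bar>) \<partial>lborel) \<partial>lborel)" by simp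
  qed
  also have "\<dots> \<le> (\<integral>\<^sup>+ \<alpha>. indicator {-1..1::real} \<alpha> * (\<integral>\<^sup>+ r. indicator {0..1::real} r * ennreal D \<partial>lborel) \<partial>lborel)"
    using pair_le[of u w 0] by (intro nn_integral_mono mult_left_mono) auto
  also have "\<dots> = ennreal 2 * ennreal D"
    by (simp add: nn_integral_multc emeasure_lborel_Icc)
  also have "\<dots> = ennreal (2 * D)" by (rule ennreal_mult'[symmetric]) simp
  finally show ?thesis .
qed

lemma far_le: "(\<integral>\<^sup>+ x. ennreal \<bar>u x\<bar> * far x \<partial>lborel) \<le> ennreal (4 * D)"
proof -
  have [measurable]: "(\<lambda>p. q (fst p) (snd p)) \<in> borel_measurable (borel \<Otimes>\<^sub>M borel)"
    unfolding slope_def by measurable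
  have "(\<integral>\<^sup>+ x. ennreal \<bar>u x\<bar> * far x \<partial>lborel) = 
     (\<integral>\<^sup>+ x. \<integral>\<^sup>+ \<alpha>. (indicator {\<alpha>. 1 \<le> \<bar>\<alpha>\<bar>} \<alpha> * ennreal (1 / \<bar>\<alpha>\<bar>)) * ennreal \<bar>u x * q x \<alpha>\<bar> \<partial>lborel \<partial>lborel)"
    unfolding far_def
    by (subst nn_integral_cmult[symmetric], (unfold slope_def, measurable)[1])
       (simp add: abs_mult ennreal_mult' mult_ac)
  also have "\<dots> = (\<integral>\<^sup>+ \<alpha>. \<integral>\<^sup>+ x. (indicator {\<alpha>. 1 \<le> \<bar>\<alpha>\<bar>} \<alpha> * ennreal (1 / \<bar>\<alpha>\<bar>)) * ennreal \<bar>u x * q x \<alpha>\<bar> \<partial>lborel \<partial>lborel)"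
    by (rule lborel_pair.Fubini') (unfold slope_def, measurable)
  also have "\<dots> = (\<integral>\<^sup>+ \<alpha>. (indicator {\<alpha>. 1 \<le> \<bar>\<alpha>\<bar>} \<alpha> * ennreal (1 / \<bar>\<alpha>\<bar>)) * (\<integral>\<^sup>+ x. ennreal \<bar>u x * q x \<alpha>\<bar> \<partial>lborel) \<partial>lborel)"
    by (intro nn_integral_cong nn_integral_cmult) measurable
  also have "\<dots> \<le> (\<integral>\<^sup>+ \<alpha>. (ennreal (1 / \<alpha>\<^sup>2) * indicator {\<alpha>. 1 \<le> \<bar>\<alpha>\<bar>} \<alpha>) * ennreal (2 * D) \<partial>lborel)"
  proof (rule nn_integral_mono)
    fix \<alpha> :: real
    show "(indicator {\<alpha>. 1 \<le> \<bar>\<alpha>\<bar>} \<alpha> * ennreal (1 / \<bar>\<alpha>\<bar>)) * (\<integral>\<^sup>+ x. ennreal \<bar>u x * q x \<alpha>\<bar> \<partial>lborel)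
      \<le> (ennreal (1 / \<alpha>\<^sup>2) * indicator {\<alpha>. 1 \<le> \<bar>\<alpha>\<bar>} \<alpha>) * ennreal (2 * D)"
    proof (cases "1 \<le> \<bar>\<alpha>\<bar>")
      case True
      then have "\<alpha> \<noteq> 0" by auto
      have "ennreal (1 / \<bar>\<alpha>\<bar>) * (\<integral>\<^sup>+ x. ennreal \<bar>u x * q x \<alpha>\<bar> \<partial>lborel) \<le> ennreal (1 / \<bar>\<alpha>\<bar>) * ennreal (1 / \<bar>\<alpha>\<bar> * (2 * D))"
        by (intro mult_left_mono uq_le \<open>\<alpha> \<noteq> 0\<close>) simp
      also have "\<dots> = ennreal (1 / \<bar>\<alpha>\<bar> * (1 / \<bar>\<alpha>\<bar> * (2 * D)))" by (rule ennreal_mult'[symmetric]) simp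
      also have "1 / \<bar>\<alpha>\<bar> * (1 / \<bar>\<alpha>\<bar> * (2 * D)) = 1 / \<alpha>\<^sup>2 * (2 * D)" by (simp add: power2_eq_square)
      also have "ennreal (1 / \<alpha>\<^sup>2 * (2 * D)) = ennreal (1 / \<alpha>\<^sup>2) * ennreal (2 * D)" by (rule ennreal_mult') simp
      finally show ?thesis using True by simp
    qed simp
  qed
  also have "\<dots> = (\<integral>\<^sup>+ \<alpha>\<in>{\<alpha>. 1 \<le> \<bar>\<alpha>\<bar>}. ennreal (1 / \<alpha>\<^sup>2) \<partial>lborel) * ennreal (2 * D)"
    by (rule nn_integral_multc) measurable
  also have "\<dots> \<le> ennreal 2 * ennreal (2 * D)" 
    by (intro mult_right_mono nn_integral_inverse_square) simp
  also have "\<dots> = ennreal (2 * (2 * D))" by (rule ennreal_mult'[symmetric]) simp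
  finally show ?thesis by simp
qed

lemma majorant_le: "(\<integral>\<^sup>+ x. ennreal \<bar>u x\<bar> * majorant x \<partial>lborel) \<le> ennreal majorant_bound"
proof -
  have "(\<integral>\<^sup>+ x. ennreal \<bar>u x\<bar> * majorant x \<partial>lborel) = 
    (\<integral>\<^sup>+ x. ennreal \<bar>u x\<bar> * near x + (ennreal \<bar>u x * q x 1\<bar> + ennreal \<bar>u x * q x (-1)\<bar>) + ennreal (2 + D) * (ennreal \<bar>u x\<bar> * far x) \<partial>lborel)"
    unfolding majorant_def abs_mult ennreal_mult'[OF abs_ge_zero] by (simp add: distrib_left mult_ac)
  also have "\<dots> = (\<integral>\<^sup>+ x. ennreal \<bar>u x\<bar> * near x \<partial>lborel) + 
     ((\<integral>\<^sup>+ x. ennreal \<bar>u x * q x 1\<bar> \<partial>lborel) + (\<integral>\<^sup>+ x. ennreal \<bar>u x * q x (-1)\<bar> \<partial>lborel))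
     + ennreal (2 + D) * (\<integral>\<^sup>+ x. ennreal \<bar>u x\<bar> * far x \<partial>lborel)"
    by (simp add: nn_integral_add nn_integral_cmult del: ennreal_plus)
  also have "\<dots> \<le> ennreal (2 * D) + (ennreal (1 / \<bar>1\<bar> * (2 * D)) + ennreal (1 / \<bar>-1\<bar> * (2 * D))) + ennreal (2 + D) * ennreal (4 * D)"
    by (intro add_mono mult_left_mono near_le far_le uq_le) auto
  also have "ennreal (2 + D) * ennreal (4 * D) = ennreal ((2 + D) * (4 * D))"
    by (rule ennreal_mult'[symmetric]) (use D_nonneg in simp)
  also have "ennreal (2 * D) + (ennreal (1 / \<bar>1\<bar> * (2 * D)) + ennreal (1 / \<bar>-1\<bar> * (2 * D))) + ennreal ((2 + D) * (4 * D)) = 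
      ennreal (2 * D + ((1 / \<bar>1\<bar> * (2 * D)) + (1 / \<bar>-1\<bar> * (2 * D))) + ((2 + D) * (4 * D)))"
    using D_nonneg by (subst ennreal_plus[symmetric]; (simp del: ennreal_plus)?)+
  finally show ?thesis by (simp add: majorant_bound_def)
qed

end

section \<open>Passage to the principal value\<close>

context H2_profile
begin

text \<open>The square of an average is a double average of products, so Tonelli applies. Unlike the bound
  $O(\alpha^{-2})$, this one is uniform as $\alpha \to 0$, where it makes the edge values of $G$ vanish.\<close>
lemma qq_le_D:
  assumes "\<alpha> \<noteq> 0"
  shows "(\<integral>\<^sup>+ x. ennreal ((q x \<alpha>)\<^sup>2) \<partial>lborel) \<le> ennreal D"
proof -
  let ?I = "indicator {0..1} :: real \<Rightarrow> ennreal"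
  have "(\<integral>\<^sup>+ x. ennreal ((q x \<alpha>)\<^sup>2) \<partial>lborel) \<le>
     (\<integral>\<^sup>+ x. \<integral>\<^sup>+ r. ?I r * (\<integral>\<^sup>+ s. ?I s * ennreal (\<bar>v (x - r * \<alpha>)\<bar> * \<bar>v (x - s * \<alpha>)\<bar>) \<partial>lborel) \<partial>lborel \<partial>lborel)"
  proof (rule nn_integral_mono)
    fix x
    let ?J = "\<integral>\<^sup>+ r. ?I r * ennreal \<bar>v (x - r * \<alpha>)\<bar> \<partial>lborel"
    have le: "ennreal \<bar>q x \<alpha>\<bar> \<le> ?J"
      using has_ac_deriv_diff_le_scaled[OF uv assms, of x] by (simp add: slope_def abs_divide mult.commute)
    have "ennreal ((q x \<alpha>)\<^sup>2) = ennreal \<bar>q x \<alpha>\<bar> * ennreal \<bar>q x \<alpha>\<bar>"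
      by (simp add: ennreal_mult'[symmetric] power2_eq_square)
    also have "\<dots> \<le> ?J * ?J" by (intro mult_mono le) auto
    also have "\<dots> = (\<integral>\<^sup>+ r. ?I r * (ennreal \<bar>v (x - r * \<alpha>)\<bar> * ?J) \<partial>lborel)"
      by (subst nn_integral_multc[symmetric]) (auto simp: mult_ac)
    also have "\<dots> = (\<integral>\<^sup>+ r. ?I r * (\<integral>\<^sup>+ s. ?I s * ennreal (\<bar>v (x - r * \<alpha>)\<bar> * \<bar>v (x - s * \<alpha>)\<bar>) \<partial>lborel) \<partial>lborel)"
      by (subst nn_integral_cmult[symmetric]) (auto simp: mult_ac ennreal_mult')
    finally show "ennreal ((q x \<alpha>)\<^sup>2) \<le> (\<integral>\<^sup>+ r. ?I r * (\<integral>\<^sup>+ s. ?I s * ennreal (\<bar>v (x - r * \<alpha>)\<bar> * \<bar>v (x - s * \<alpha>)\<bar>) \<partial>lborel) \<partial>lborel)" .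
  qed
  also have "\<dots> = (\<integral>\<^sup>+ r. \<integral>\<^sup>+ x. ?I r * (\<integral>\<^sup>+ s. ?I s * ennreal (\<bar>v (x - r * \<alpha>)\<bar> * \<bar>v (x - s * \<alpha>)\<bar>) \<partial>lborel) \<partial>lborel \<partial>lborel)"
    by (rule lborel_pair.Fubini') measurable
  also have "\<dots> = (\<integral>\<^sup>+ r. ?I r * (\<integral>\<^sup>+ x. \<integral>\<^sup>+ s. ?I s * ennreal (\<bar>v (x - r * \<alpha>)\<bar> * \<bar>v (x - s * \<alpha>)\<bar>) \<partial>lborel \<partial>lborel) \<partial>lborel)"
    by (intro nn_integral_cong nn_integral_cmult) measurable
  also have "\<dots> = (\<integral>\<^sup>+ r. ?I r * (\<integral>\<^sup>+ s. ?I s * (\<integral>\<^sup>+ x. ennreal (\<bar>v (x - r * \<alpha>)\<bar> * \<bar>v (x - s * \<alpha>)\<bar>) \<partial>lborel) \<partial>lborel) \<partial>lborel)"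
  proof (rule nn_integral_cong)
    fix r
    have "(\<integral>\<^sup>+ x. \<integral>\<^sup>+ s. ?I s * ennreal (\<bar>v (x - r * \<alpha>)\<bar> * \<bar>v (x - s * \<alpha>)\<bar>) \<partial>lborel \<partial>lborel) = 
      (\<integral>\<^sup>+ s. \<integral>\<^sup>+ x. ?I s * ennreal (\<bar>v (x - r * \<alpha>)\<bar> * \<bar>v (x - s * \<alpha>)\<bar>) \<partial>lborel \<partial>lborel)"
      by (rule lborel_pair.Fubini') measurable
    also have "\<dots> = (\<integral>\<^sup>+ s. ?I s * (\<integral>\<^sup>+ x. ennreal (\<bar>v (x - r * \<alpha>)\<bar> * \<bar>v (x - s * \<alpha>)\<bar>) \<partial>lborel) \<partial>lborel)"
      by (intro nn_integral_cong nn_integral_cmult) measurable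
    finally show "?I r * (\<integral>\<^sup>+ x. \<integral>\<^sup>+ s. ?I s * ennreal (\<bar>v (x - r * \<alpha>)\<bar> * \<bar>v (x - s * \<alpha>)\<bar>) \<partial>lborel \<partial>lborel) = 
      ?I r * (\<integral>\<^sup>+ s. ?I s * (\<integral>\<^sup>+ x. ennreal (\<bar>v (x - r * \<alpha>)\<bar> * \<bar>v (x - s * \<alpha>)\<bar>) \<partial>lborel) \<partial>lborel)" by simp
  qed
  also have "\<dots> \<le> (\<integral>\<^sup>+ r. ?I r * (\<integral>\<^sup>+ s. ?I s * ennreal D \<partial>lborel) \<partial>lborel)"
    by (intro nn_integral_mono mult_left_mono pair_le) auto
  also have "\<dots> = ennreal D"
    by (simp add: nn_integral_multc emeasure_lborel_Icc)
  finally show ?thesis .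
qed

lemma abs_integral_le:
  fixes k :: "real \<Rightarrow> real"
  assumes "k \<in> borel_measurable borel" "(\<integral>\<^sup>+ x. ennreal \<bar>k x\<bar> \<partial>lborel) \<le> ennreal B" "B \<ge> 0"
  shows "integrable lborel k" "\<bar>LBINT x. k x\<bar> \<le> B"
proof -
  show i: "integrable lborel k" by (rule integrable_nn_bound[OF assms(1,2)])
  have "ennreal \<bar>LBINT x. k x\<bar> \<le> ennreal B"
    using order.trans[OF integral_norm_bound_ennreal[OF i] , of "ennreal B"] assms(2) by simp
  then show "\<bar>LBINT x. k x\<bar> \<le> B" using assms(3) by (subst (asm) ennreal_le_iff) auto
qed

lemma boundary_le:
  assumes "\<alpha> \<noteq> 0"
  shows "integrable lborel (\<lambda>x. \<alpha> * arctan_primitive (q x \<alpha>))"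
    and "\<bar>LBINT x. \<alpha> * arctan_primitive (q x \<alpha>)\<bar> \<le> D * \<bar>\<alpha>\<bar>"
    and "\<bar>LBINT x. \<alpha> * arctan_primitive (q x \<alpha>)\<bar> \<le> 4 * D / \<bar>\<alpha>\<bar>"
proof -
  have [measurable]: "arctan_primitive \<in> borel_measurable borel"
    unfolding arctan_primitive_def[abs_def] by measurable
  have le: "(\<integral>\<^sup>+ x. ennreal \<bar>\<alpha> * arctan_primitive (q x \<alpha>)\<bar> \<partial>lborel) \<le> ennreal (\<bar>\<alpha>\<bar> * B)"
    if "(\<integral>\<^sup>+ x. ennreal \<bar>(q x \<alpha>)\<^sup>2\<bar> \<partial>lborel) \<le> ennreal B" for B
  proof -
    have "(\<integral>\<^sup>+ x. ennreal \<bar>\<alpha> * arctan_primitive (q x \<alpha>)\<bar> \<partial>lborel) \<le> (\<integral>\<^sup>+ x. ennreal \<bar>\<alpha>\<bar> * ennreal \<bar>(q x \<alpha>)\<^sup>2\<bar> \<partial>lborel)"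
      unfolding abs_mult ennreal_mult'[OF abs_ge_zero]
      using abs_arctan_primitive_le by (intro nn_integral_mono mult_left_mono ennreal_leI) auto
    also have "\<dots> = ennreal \<bar>\<alpha>\<bar> * (\<integral>\<^sup>+ x. ennreal \<bar>(q x \<alpha>)\<^sup>2\<bar> \<partial>lborel)"
      by (rule nn_integral_cmult) measurable
    also have "\<dots> \<le> ennreal \<bar>\<alpha>\<bar> * ennreal B" by (intro mult_left_mono that) simp
    finally show ?thesis by (simp add: ennreal_mult')
  qed
  have m: "(\<lambda>x. \<alpha> * arctan_primitive (q x \<alpha>)) \<in> borel_measurable borel" by measurable
  note 1 = abs_integral_le[OF m le[of D]] and 2 = abs_integral_le[OF m le[OF qq_le[OF assms]]]
  show "integrable lborel (\<lambda>x. \<alpha> * arctan_primitive (q x \<alpha>))"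
    and "\<bar>LBINT x. \<alpha> * arctan_primitive (q x \<alpha>)\<bar> \<le> D * \<bar>\<alpha>\<bar>"
    using 1 qq_le_D[OF assms] D_nonneg by (auto simp: mult.commute)
  have "\<bar>\<alpha>\<bar> * (2 / \<alpha>\<^sup>2 * (2 * D)) = 4 * D / \<bar>\<alpha>\<bar>"
    using assms by (auto simp: power2_eq_square field_simps abs_if)
  then show "\<bar>LBINT x. \<alpha> * arctan_primitive (q x \<alpha>)\<bar> \<le> 4 * D / \<bar>\<alpha>\<bar>"
    using 2(2) D_nonneg by auto
qed

definition log_slice :: "real \<Rightarrow> real" where
  "log_slice \<alpha> = (LBINT x. ln (1 + (q x \<alpha>)\<^sup>2))"

definition truncated_log :: "real \<Rightarrow> real" where
  "truncated_log \<epsilon> = (LBINT \<alpha>:{\<epsilon>..1/\<epsilon>}. log_slice \<alpha>) + (LBINT \<alpha>:{-(1/\<epsilon>)..-\<epsilon>}. log_slice \<alpha>)"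

lemma u_truncated_integral:
  assumes "0 < \<epsilon>" "\<epsilon> < 1"
  shows "integrable lborel (\<lambda>x. u x * truncated \<epsilon> x)" "\<bar>(LBINT x. u x * truncated \<epsilon> x) + truncated_log \<epsilon> / 2\<bar> \<le> 10 * D * \<epsilon>"
proof -
  define R where "R = 1 / \<epsilon>"
  have "\<epsilon> * \<epsilon> < 1 * 1" using assms by (intro mult_strict_mono) auto
  then have R: "\<epsilon> < R" "R > 0" using assms unfolding R_def by (simp_all add: less_divide_eq)
  have z: "0 \<notin> {\<epsilon>..R}" "0 \<notin> {-R..-\<epsilon>}" using assms R by auto
  have i: "integrable lborel (\<lambda>x. u x * (LBINT \<alpha>:{\<epsilon>..R}. M x \<alpha>))"
     "integrable lborel (\<lambda>x. u x * (LBINT \<alpha>:{-R..-\<epsilon>}. M x \<alpha>))"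
    using strip_identity(1)[of \<epsilon> R] strip_identity(1)[of "-R" "-\<epsilon>"] R z by auto
  have F: "u x * truncated \<epsilon> x = u x * (LBINT \<alpha>:{\<epsilon>..R}. M x \<alpha>) + u x * (LBINT \<alpha>:{-R..-\<epsilon>}. M x \<alpha>)" for x
    unfolding truncated_split[OF assms] R_def by (simp add: algebra_simps)
  show "integrable lborel (\<lambda>x. u x * truncated \<epsilon> x)" unfolding F using i by simp
  let ?P = "\<lambda>\<alpha>. LBINT x. \<alpha> * arctan_primitive (q x \<alpha>)"
  have P: "(LBINT x. b * arctan_primitive (q x b) - a * arctan_primitive (q x a)) = ?P b - ?P a"
    if "a \<noteq> 0" "b \<noteq> 0" for a b
    by (rule Bochner_Integration.integral_diff) (intro boundary_le that)+
  have lin: "\<bar>p + (s + s') / 2\<bar> \<le> \<bar>a\<bar> + \<bar>b\<bar> + \<bar>c\<bar> + \<bar>d\<bar>"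
    if "p = - s / 2 - (a - b) + (- s' / 2 - (c - d))" for p s s' a b c d :: real
  proof -
    have "p + (s + s') / 2 = (b + - a) + (d + - c)" unfolding that by (simp add: field_simps)
    also have "\<bar>\<dots>\<bar> \<le> (\<bar>b\<bar> + \<bar>-a\<bar>) + (\<bar>d\<bar> + \<bar>-c\<bar>)"
      by (intro order.trans[OF abs_triangle_ineq] add_mono abs_triangle_ineq)
    finally show ?thesis by (simp only: abs_minus_cancel ac_simps)
  qed
  have "(LBINT x. u x * truncated \<epsilon> x) = (LBINT x. u x * (LBINT \<alpha>:{\<epsilon>..R}. M x \<alpha>)) + (LBINT x. u x * (LBINT \<alpha>:{-R..-\<epsilon>}. M x \<alpha>))"
    unfolding F using i by simp
  also have "(LBINT x. u x * (LBINT \<alpha>:{\<epsilon>..R}. M x \<alpha>)) = - (LBINT \<alpha>:{\<epsilon>..R}. log_slice \<alpha>) / 2 - (?P R - ?P \<epsilon>)"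
    unfolding log_slice_def using R assms z by (subst strip_identity(2)[OF _ z(1)], simp, subst P) auto
  also have "(LBINT x. u x * (LBINT \<alpha>:{-R..-\<epsilon>}. M x \<alpha>)) = - (LBINT \<alpha>:{-R..-\<epsilon>}. log_slice \<alpha>) / 2 - (?P (-\<epsilon>) - ?P (-R))"
    unfolding log_slice_def using R assms z by (subst strip_identity(2)[OF _ z(2)], simp, subst P) auto
  finally have "\<bar>(LBINT x. u x * truncated \<epsilon> x) + truncated_log \<epsilon> / 2\<bar> \<le> \<bar>?P R\<bar> + \<bar>?P \<epsilon>\<bar> + \<bar>?P (-\<epsilon>)\<bar> + \<bar>?P (-R)\<bar>"
    unfolding truncated_log_def R_def[symmetric] by (rule lin)
  also have "\<dots> \<le> 4 * D / \<bar>R\<bar> + D * \<bar>\<epsilon>\<bar> + D * \<bar>-\<epsilon>\<bar> + 4 * D / \<bar>-R\<bar>"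
    using R assms by (intro add_mono boundary_le) auto
  also have "\<dots> = 10 * D * \<epsilon>"
    using assms unfolding R_def by (simp add: algebra_simps)
  finally show "\<bar>(LBINT x. u x * truncated \<epsilon> x) + truncated_log \<epsilon> / 2\<bar> \<le> 10 * D * \<epsilon>" .
qed

lemma abs_end_terms_le: "\<bar>end_terms \<epsilon> x\<bar> \<le> \<bar>q x (1 / \<epsilon>)\<bar> + \<bar>q x (- (1 / \<epsilon>))\<bar>"
  using abs_arctan_le[of "q x (1 / \<epsilon>)"] abs_arctan_le[of "q x (- (1 / \<epsilon>))"] unfolding end_terms_def by linarith

lemma end_terms_le: "\<epsilon> > 0 \<Longrightarrow> \<bar>end_terms \<epsilon> x\<bar> \<le> 4 * (1 + D) * \<epsilon>"
proof -
  assume "\<epsilon> > 0"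
  have "\<bar>q x a\<bar> \<le> (1 / \<bar>a\<bar>) * (2 * (1 + D))" for a
    using u_bound[of x] u_bound[of "x - a"] by (intro order.trans[OF abs_slope_le mult_left_mono]) auto
  from this[of "1/\<epsilon>"] this[of "-(1/\<epsilon>)"] \<open>\<epsilon> > 0\<close> abs_end_terms_le[of \<epsilon> x] show ?thesis by (simp add: algebra_simps)
qed

lemma measurable_end_terms [measurable]: "end_terms \<epsilon> \<in> borel_measurable borel"
  unfolding end_terms_def[abs_def] by measurable

lemma u_end_terms_integral:
  assumes "\<epsilon> > 0"
  shows "integrable lborel (\<lambda>x. u x * end_terms \<epsilon> x)" "\<bar>LBINT x. u x * end_terms \<epsilon> x\<bar> \<le> 4 * D * \<epsilon>"
proof -
  have "(\<integral>\<^sup>+ x. ennreal \<bar>u x * end_terms \<epsilon> x\<bar> \<partial>lborel) \<le> (\<integral>\<^sup>+ x. ennreal \<bar>u x * q x (1/\<epsilon>)\<bar> + ennreal \<bar>u x * q x (-(1/\<epsilon>))\<bar> \<partial>lborel)"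
  proof (rule nn_integral_mono)
    fix x
    have "\<bar>u x\<bar> * \<bar>end_terms \<epsilon> x\<bar> \<le> \<bar>u x\<bar> * (\<bar>q x (1 / \<epsilon>)\<bar> + \<bar>q x (- (1 / \<epsilon>))\<bar>)"
      by (rule mult_left_mono[OF abs_end_terms_le]) simp
    then have "ennreal \<bar>u x * end_terms \<epsilon> x\<bar> \<le> ennreal (\<bar>u x * q x (1/\<epsilon>)\<bar> + \<bar>u x * q x (-(1/\<epsilon>))\<bar>)"
      by (intro ennreal_leI) (simp add: abs_mult algebra_simps)
    then show "ennreal \<bar>u x * end_terms \<epsilon> x\<bar> \<le> ennreal \<bar>u x * q x (1/\<epsilon>)\<bar> + ennreal \<bar>u x * q x (-(1/\<epsilon>))\<bar>"
      by simp
  qed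
  also have "\<dots> = (\<integral>\<^sup>+ x. ennreal \<bar>u x * q x (1/\<epsilon>)\<bar> \<partial>lborel) + (\<integral>\<^sup>+ x. ennreal \<bar>u x * q x (-(1/\<epsilon>))\<bar> \<partial>lborel)"
    by (rule nn_integral_add) measurable
  also have "\<dots> \<le> ennreal (1 / \<bar>1/\<epsilon>\<bar> * (2 * D)) + ennreal (1 / \<bar>-(1/\<epsilon>)\<bar> * (2 * D))"
    using assms by (intro add_mono uq_le) auto
  also have "\<dots> = ennreal (1 / \<bar>1/\<epsilon>\<bar> * (2 * D) + 1 / \<bar>-(1/\<epsilon>)\<bar> * (2 * D))"
    by (rule ennreal_plus[symmetric]) (use assms D_nonneg in auto)
  also have "1 / \<bar>1/\<epsilon>\<bar> * (2 * D) + 1 / \<bar>-(1/\<epsilon>)\<bar> * (2 * D) = 4 * D * \<epsilon>"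
    using assms by (simp add: algebra_simps)
  finally have le: "(\<integral>\<^sup>+ x. ennreal \<bar>u x * end_terms \<epsilon> x\<bar> \<partial>lborel) \<le> ennreal (4 * D * \<epsilon>)" .
  show "integrable lborel (\<lambda>x. u x * end_terms \<epsilon> x)" "\<bar>LBINT x. u x * end_terms \<epsilon> x\<bar> \<le> 4 * D * \<epsilon>"
    by (rule abs_integral_le[OF _ le]; use assms D_nonneg in simp)+
qed

lemma log_slice_eq:
  assumes "\<alpha> \<noteq> 0"
  shows "ennreal (log_slice \<alpha>) = (\<integral>\<^sup>+ x. ennreal (ln (1 + (q x \<alpha>)\<^sup>2)) \<partial>lborel)" "log_slice \<alpha> \<ge> 0"
proof -
  have "integrable lborel (\<lambda>x. ln (1 + (q x \<alpha>)\<^sup>2))"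
    by (rule integrable_nn_bound[OF _ ln_le[OF assms]]) measurable
  then show "ennreal (log_slice \<alpha>) = (\<integral>\<^sup>+ x. ennreal (ln (1 + (q x \<alpha>)\<^sup>2)) \<partial>lborel)"
    unfolding log_slice_def by (subst nn_integral_eq_integral) auto
  show "log_slice \<alpha> \<ge> 0" unfolding log_slice_def by (rule Bochner_Integration.integral_nonneg) simp
qed

lemma measurable_log_slice [measurable]: "log_slice \<in> borel_measurable borel"
  unfolding log_slice_def[abs_def] slope_def by measurable

lemma log_slice_le: "\<alpha> \<noteq> 0 \<Longrightarrow> log_slice \<alpha> \<le> D"
proof -
  assume a: "\<alpha> \<noteq> 0"
  have "ennreal (log_slice \<alpha>) \<le> (\<integral>\<^sup>+ x. ennreal ((q x \<alpha>)\<^sup>2) \<partial>lborel)"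
    unfolding log_slice_eq[OF a] by (intro nn_integral_mono ennreal_leI ln_one_plus_square_bounds)
  also note qq_le_D[OF a]
  finally show "log_slice \<alpha> \<le> D" using D_nonneg by (subst (asm) ennreal_le_iff) auto
qed

lemma truncated_log_eq:
  assumes "\<epsilon> > 0"
  shows "ennreal (truncated_log \<epsilon>) = (\<integral>\<^sup>+ \<alpha>. indicator ({\<epsilon>..1/\<epsilon>} \<union> {-(1/\<epsilon>)..-\<epsilon>}) \<alpha> * (\<integral>\<^sup>+ x. ennreal (ln (1 + (q x \<alpha>)\<^sup>2)) \<partial>lborel) \<partial>lborel)"
    "truncated_log \<epsilon> \<ge> 0"
proof -
  have i: "set_integrable lborel {a..b} log_slice" if "0 \<notin> {a..b}" for a b
    unfolding set_integrable_def
  proof (rule Bochner_Integration.integrable_bound)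
    show "integrable lborel (\<lambda>x. indicator {a..b} x * D)" by (auto simp: emeasure_lborel_Icc_eq)
    show "AE x in lborel. norm (indicat_real {a..b} x *\<^sub>R log_slice x) \<le> norm (indicat_real {a..b} x * D)"
      using log_slice_le log_slice_eq(2) that D_nonneg by (intro AE_I2) (auto simp: indicator_def)
  qed measurable
  have n: "(LBINT \<alpha>:{a..b}. log_slice \<alpha>) \<ge> 0" 
    "ennreal (LBINT \<alpha>:{a..b}. log_slice \<alpha>) = (\<integral>\<^sup>+ \<alpha>. indicator {a..b} \<alpha> * (\<integral>\<^sup>+ x. ennreal (ln (1 + (q x \<alpha>)\<^sup>2)) \<partial>lborel) \<partial>lborel)"
    if z: "0 \<notin> {a..b}" for a b
  proof -
    have nn: "0 \<le> indicator {a..b} \<alpha> *\<^sub>R log_slice \<alpha>" for \<alpha> using log_slice_eq(2)[of \<alpha>] z by (auto simp: indicator_def)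
    show "(LBINT \<alpha>:{a..b}. log_slice \<alpha>) \<ge> 0" unfolding set_lebesgue_integral_def
      by (rule Bochner_Integration.integral_nonneg) (rule nn)
    have "ennreal (LBINT \<alpha>:{a..b}. log_slice \<alpha>) = (\<integral>\<^sup>+ \<alpha>. ennreal (indicator {a..b} \<alpha> *\<^sub>R log_slice \<alpha>) \<partial>lborel)"
      unfolding set_lebesgue_integral_def using i[OF z, unfolded set_integrable_def] nn
      by (intro nn_integral_eq_integral[symmetric]) auto
    also have "\<dots> = (\<integral>\<^sup>+ \<alpha>. indicator {a..b} \<alpha> * (\<integral>\<^sup>+ x. ennreal (ln (1 + (q x \<alpha>)\<^sup>2)) \<partial>lborel) \<partial>lborel)"
      using log_slice_eq(1) z by (intro nn_integral_cong) (auto simp: indicator_def)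
    finally show "ennreal (LBINT \<alpha>:{a..b}. log_slice \<alpha>) = \<dots>" .
  qed
  have z: "0 \<notin> {\<epsilon>..1/\<epsilon>}" "0 \<notin> {-(1/\<epsilon>)..-\<epsilon>}" using assms by auto
  show "truncated_log \<epsilon> \<ge> 0" unfolding truncated_log_def using n(1)[OF z(1)] n(1)[OF z(2)] by simp
  have "ennreal (truncated_log \<epsilon>) = ennreal (LBINT \<alpha>:{\<epsilon>..1/\<epsilon>}. log_slice \<alpha>) + ennreal (LBINT \<alpha>:{-(1/\<epsilon>)..-\<epsilon>}. log_slice \<alpha>)"
    unfolding truncated_log_def by (rule ennreal_plus) (rule n(1)[OF z(1)] n(1)[OF z(2)])+
  also have "\<dots> = (\<integral>\<^sup>+ \<alpha>. indicator {\<epsilon>..1/\<epsilon>} \<alpha> * (\<integral>\<^sup>+ x. ennreal (ln (1 + (q x \<alpha>)\<^sup>2)) \<partial>lborel) +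
     indicator {-(1/\<epsilon>)..-\<epsilon>} \<alpha> * (\<integral>\<^sup>+ x. ennreal (ln (1 + (q x \<alpha>)\<^sup>2)) \<partial>lborel) \<partial>lborel)"
    unfolding n(2)[OF z(1)] n(2)[OF z(2)] slope_def by (rule nn_integral_add[symmetric]) measurable
  also have "\<dots> = (\<integral>\<^sup>+ \<alpha>. indicator ({\<epsilon>..1/\<epsilon>} \<union> {-(1/\<epsilon>)..-\<epsilon>}) \<alpha> * (\<integral>\<^sup>+ x. ennreal (ln (1 + (q x \<alpha>)\<^sup>2)) \<partial>lborel) \<partial>lborel)"
    using assms by (intro nn_integral_cong) (auto simp: indicator_def)
  finally show "ennreal (truncated_log \<epsilon>) = \<dots>" .
qed

lemma nn_log_eq:
  "(\<integral>\<^sup>+ \<alpha>. (\<integral>\<^sup>+ x. ennreal (ln (1 + ((u x - u \<alpha>) / (x - \<alpha>))\<^sup>2)) \<partial>lborel) \<partial>lborel)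
    = (\<integral>\<^sup>+ \<alpha>. \<integral>\<^sup>+ x. ennreal (ln (1 + (q x \<alpha>)\<^sup>2)) \<partial>lborel \<partial>lborel)"
proof -
  have "(\<integral>\<^sup>+ \<alpha>. (\<integral>\<^sup>+ x. ennreal (ln (1 + ((u x - u \<alpha>) / (x - \<alpha>))\<^sup>2)) \<partial>lborel) \<partial>lborel)
     = (\<integral>\<^sup>+ x. (\<integral>\<^sup>+ \<alpha>. ennreal (ln (1 + ((u x - u \<alpha>) / (x - \<alpha>))\<^sup>2)) \<partial>lborel) \<partial>lborel)"
    by (rule lborel_pair.Fubini') measurable
  also have "\<dots> = (\<integral>\<^sup>+ x. (\<integral>\<^sup>+ \<alpha>. ennreal (ln (1 + (q x \<alpha>)\<^sup>2)) \<partial>lborel) \<partial>lborel)"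
  proof (rule nn_integral_cong)
    fix x
    show "(\<integral>\<^sup>+ \<alpha>. ennreal (ln (1 + ((u x - u \<alpha>) / (x - \<alpha>))\<^sup>2)) \<partial>lborel) = (\<integral>\<^sup>+ \<alpha>. ennreal (ln (1 + (q x \<alpha>)\<^sup>2)) \<partial>lborel)"
      by (subst nn_integral_real_affine[of _ "-1" x]) (auto simp: slope_def)
  qed
  also have "\<dots> = (\<integral>\<^sup>+ \<alpha>. (\<integral>\<^sup>+ x. ennreal (ln (1 + (q x \<alpha>)\<^sup>2)) \<partial>lborel) \<partial>lborel)"
    by (rule lborel_pair.Fubini') (unfold slope_def, measurable)
  finally show ?thesis .
qed

lemma measurable_truncated [measurable]: "truncated \<epsilon> \<in> borel_measurable borel"
  unfolding truncated_def[abs_def] set_lebesgue_integral_def by measurable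

text \<open>Dominated convergence on the left-hand side of the strip identity and monotone convergence on the right-hand side.
  The bound by \<open>majorant_bound\<close>, which depends on $D$ alone, is what later allows integration in time.\<close>
lemma PV_identity:
  assumes PV: "\<And>x. has_PV_integral (M x) (I x)"
  shows "I \<in> borel_measurable borel" "(\<integral>\<^sup>+ x. ennreal \<bar>u x * I x\<bar> \<partial>lborel) \<le> ennreal majorant_bound"
    and "integrable lborel (\<lambda>x. u x * I x)"
    and "(LBINT x. u x * I x) \<le> 0"
    and "(\<integral>\<^sup>+ \<alpha>. (\<integral>\<^sup>+ x. ennreal (ln (1 + ((u x - u \<alpha>) / (x - \<alpha>))\<^sup>2)) \<partial>lborel) \<partial>lborel)
         = ennreal (- 2 * (LBINT x. u x * I x))"
proof -
  \<comment> \<open>A sequence decreasing to $0$ inside $(0,1)$, where the majorant is available.\<close>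
  define e :: "nat \<Rightarrow> real" where "e n = 1 / (real n + 2)" for n
  have e: "0 < e n" "e n < 1" for n by (auto simp: e_def)
  have e0: "e \<longlonglongrightarrow> 0" unfolding e_def[abs_def]
    using LIMSEQ_ignore_initial_segment[OF lim_1_over_n[where 'a = real], of 2] by (simp add: add.commute)
  have er: "filterlim e (at_right 0) sequentially"
    using e0 e(1) less_imp_neq[OF e(1)] by (auto simp: filterlim_at)
  have lF: "(\<lambda>n. truncated (e n) x) \<longlonglongrightarrow> I x" for x
    using filterlim_compose[OF conjunct2[OF PV[of x, unfolded has_PV_integral_def]] er]
    unfolding truncated_def .
  have lE: "(\<lambda>n. end_terms (e n) x) \<longlonglongrightarrow> 0" for x
  proof (rule Lim_null_comparison)
    show "\<forall>\<^sub>F n in sequentially. norm (end_terms (e n) x) \<le> 4 * (1 + D) * e n"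
      using end_terms_le e by simp
    show "(\<lambda>n. 4 * (1 + D) * e n) \<longlonglongrightarrow> 0" using tendsto_mult_right_zero[OF e0] .
  qed
  show mI [measurable]: "I \<in> borel_measurable borel"
    by (rule borel_measurable_LIMSEQ_real[OF lF]) measurable
  have lFE: "(\<lambda>n. truncated (e n) x + end_terms (e n) x) \<longlonglongrightarrow> I x" for x
    using tendsto_add[OF lF lE] by simp
  have Ile: "ennreal \<bar>I x\<bar> \<le> majorant x" for x
  proof (rule LIMSEQ_le_const2)
    show "(\<lambda>n. ennreal \<bar>truncated (e n) x + end_terms (e n) x\<bar>) \<longlonglongrightarrow> ennreal \<bar>I x\<bar>"
      by (intro tendsto_ennrealI tendsto_rabs lFE)
  qed (use truncated_le_majorant e in auto)
  show "(\<integral>\<^sup>+ x. ennreal \<bar>u x * I x\<bar> \<partial>lborel) \<le> ennreal majorant_bound"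
    by (rule order.trans[OF nn_integral_mono majorant_le])
       (auto simp: abs_mult ennreal_mult' intro!: mult_left_mono Ile)
  let ?g = "\<lambda>x. ennreal \<bar>u x\<bar> * majorant x"
  have fin: "(\<integral>\<^sup>+ x. ?g x \<partial>lborel) < \<infinity>"
    using majorant_le by (rule order.strict_trans1) simp
  then have ae: "AE x in lborel. ?g x \<noteq> \<infinity>"
    by (intro nn_integral_PInf_AE) auto
  have ig: "integrable lborel (\<lambda>x. enn2real (?g x))"
  proof (rule integrableI_bounded)
    have "(\<integral>\<^sup>+ x. ennreal (norm (enn2real (?g x))) \<partial>lborel) \<le> (\<integral>\<^sup>+ x. ?g x \<partial>lborel)"
      by (intro nn_integral_mono) (auto simp: ennreal_enn2real_if)
    then show "(\<integral>\<^sup>+ x. ennreal (norm (enn2real (?g x))) \<partial>lborel) < \<infinity>" using fin by (rule order.strict_trans1)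
  qed measurable
  have DCT: "integrable lborel (\<lambda>x. u x * I x)" "(\<lambda>n. LBINT x. u x * (truncated (e n) x + end_terms (e n) x)) \<longlonglongrightarrow> (LBINT x. u x * I x)"
  proof -
    have b: "AE x in lborel. norm (u x * (truncated (e n) x + end_terms (e n) x)) \<le> enn2real (?g x)" for n
      using ae
    proof eventually_elim
      case (elim x)
      have "ennreal \<bar>u x * (truncated (e n) x + end_terms (e n) x)\<bar> \<le> ?g x"
        unfolding abs_mult by (subst ennreal_mult') (auto intro!: mult_left_mono truncated_le_majorant e)
      then show ?case using elim
        by (metis abs_ge_zero enn2real_ennreal enn2real_mono infinity_ennreal_def real_norm_def top.not_eq_extremum)
    qed
    have l: "AE x in lborel. (\<lambda>n. u x * (truncated (e n) x + end_terms (e n) x)) \<longlonglongrightarrow> u x * I x"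
      by (intro AE_I2 tendsto_intros lFE)
    show "integrable lborel (\<lambda>x. u x * I x)"
      by (rule integrable_dominated_convergence[OF _ _ ig l b]) measurable
    show "(\<lambda>n. LBINT x. u x * (truncated (e n) x + end_terms (e n) x)) \<longlonglongrightarrow> (LBINT x. u x * I x)"
      by (rule integral_dominated_convergence[OF _ _ ig l b]) measurable
  qed
  show "integrable lborel (\<lambda>x. u x * I x)" by (rule DCT)
  have SL: "(\<lambda>n. truncated_log (e n)) \<longlonglongrightarrow> - 2 * (LBINT x. u x * I x)"
  proof -
    let ?T = "\<lambda>n. LBINT x. u x * (truncated (e n) x + end_terms (e n) x)"
    have lin: "\<bar>X + s / 2\<bar> \<le> a \<Longrightarrow> \<bar>Y\<bar> \<le> b \<Longrightarrow> \<bar>s + 2 * (X + Y)\<bar> \<le> 2 * a + 2 * b" for X Y s a b :: real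
      by (auto simp: abs_le_iff)
    have "(\<lambda>n. truncated_log (e n) + 2 * ?T n) \<longlonglongrightarrow> 0"
    proof (rule Lim_null_comparison)
      show "\<forall>\<^sub>F n in sequentially. norm (truncated_log (e n) + 2 * ?T n) \<le> 28 * D * e n"
      proof (rule always_eventually, rule allI)
        fix n
        have "?T n = (LBINT x. u x * truncated (e n) x) + (LBINT x. u x * end_terms (e n) x)"
          unfolding distrib_left using u_truncated_integral(1)[OF e] u_end_terms_integral(1)[OF e(1)] by (rule Bochner_Integration.integral_add)
        then have "norm (truncated_log (e n) + 2 * ?T n) \<le> 2 * (10 * D * e n) + 2 * (4 * D * e n)"
          using lin[OF u_truncated_integral(2)[OF e, of n] u_end_terms_integral(2)[OF e(1), of n]] by simp
        then show "norm (truncated_log (e n) + 2 * ?T n) \<le> 28 * D * e n" by (simp add: algebra_simps)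
      qed
      show "(\<lambda>n. 28 * D * e n) \<longlonglongrightarrow> 0" using tendsto_mult_right_zero[OF e0] .
    qed
    from tendsto_diff[OF this tendsto_mult[OF tendsto_const[of 2] DCT(2)]] show ?thesis by simp
  qed
  show "(LBINT x. u x * I x) \<le> 0"
    using LIMSEQ_le_const[OF SL, of 0] truncated_log_eq(2) e by auto
  let ?L = "\<lambda>\<alpha>. \<integral>\<^sup>+ x. ennreal (ln (1 + (q x \<alpha>)\<^sup>2)) \<partial>lborel"
  let ?A = "\<lambda>n. {e n..1/e n} \<union> {-(1/e n)..-e n}"
  have Lm [measurable]: "?L \<in> borel_measurable borel" unfolding slope_def by measurable
  have "(\<lambda>n. \<integral>\<^sup>+ \<alpha>. indicator (?A n) \<alpha> * ?L \<alpha> \<partial>lborel) \<longlonglongrightarrow> (\<integral>\<^sup>+ \<alpha>. ?L \<alpha> \<partial>lborel)"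
  proof (rule nn_integral_LIMSEQ)
    have mono: "?A m \<subseteq> ?A n" if "m \<le> n" for m n
    proof -
      have "e n \<le> e m" using that by (auto simp: e_def intro!: divide_left_mono)
      moreover have "1 / e m \<le> 1 / e n" using that by (auto simp: e_def)
      ultimately show ?thesis by auto
    qed
    show "incseq (\<lambda>n \<alpha>. indicator (?A n) \<alpha> * ?L \<alpha>)"
    proof (intro incseq_SucI le_funI mult_right_mono)
      fix n \<alpha> show "indicator (?A n) \<alpha> \<le> (indicator (?A (Suc n)) \<alpha> :: ennreal)"
        using mono[of n "Suc n"] by (auto simp: indicator_def)
    qed simp
    show "(\<lambda>n. indicator (?A n) \<alpha> * ?L \<alpha>) \<longlonglongrightarrow> ?L \<alpha>" for \<alpha>
    proof (cases "\<alpha> = 0")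
      case True
      then show ?thesis by (simp add: slope_def)
    next
      case False
      have "\<forall>\<^sub>F n in sequentially. e n < min \<bar>\<alpha>\<bar> (1 / \<bar>\<alpha>\<bar>)"
        by (rule order_tendstoD(2)[OF e0]) (use False in simp)
      then have "\<forall>\<^sub>F n in sequentially. indicator (?A n) \<alpha> * ?L \<alpha> = ?L \<alpha>"
      proof eventually_elim
        case (elim n)
        then have "e n \<le> \<bar>\<alpha>\<bar>" "\<bar>\<alpha>\<bar> \<le> 1 / e n" using e[of n] False by (auto simp: field_simps)
        then have "\<alpha> \<in> ?A n" by (cases "\<alpha> > 0") auto
        then show ?case by simp
      qed
      then show ?thesis by (rule tendsto_eventually)
    qed
  qed measurable
  then have "(\<lambda>n. ennreal (truncated_log (e n))) \<longlonglongrightarrow> (\<integral>\<^sup>+ \<alpha>. ?L \<alpha> \<partial>lborel)"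
    using truncated_log_eq(1)[OF e(1)] by simp
  moreover have "(\<lambda>n. ennreal (truncated_log (e n))) \<longlonglongrightarrow> ennreal (- 2 * (LBINT x. u x * I x))"
    by (rule tendsto_ennrealI[OF SL])
  ultimately show "(\<integral>\<^sup>+ \<alpha>. (\<integral>\<^sup>+ x. ennreal (ln (1 + ((u x - u \<alpha>) / (x - \<alpha>))\<^sup>2)) \<partial>lborel) \<partial>lborel)
         = ennreal (- 2 * (LBINT x. u x * I x))"
    unfolding nn_log_eq by (rule LIMSEQ_unique)
qed

end

section \<open>The logarithmic integral and the $L^1$ norm\<close>

lemma Lp_norm_1: "Lp_norm 1 u = (\<integral>\<^sup>+ x. ennreal \<bar>u x\<bar> \<partial>lborel)"
  unfolding Lp_norm_def Let_def by (auto simp: less_top[symmetric])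

lemma Lp_norm_2_square: "(Lp_norm 2 u)\<^sup>2 = (\<integral>\<^sup>+ x. ennreal ((u x)\<^sup>2) \<partial>lborel)"
proof -
  define I where "I = (\<integral>\<^sup>+ x. ennreal ((u x)\<^sup>2) \<partial>lborel)"
  have L: "Lp_norm 2 u = (if I = \<infinity> then \<infinity> else ennreal (enn2real I powr (1 / 2)))"
    unfolding Lp_norm_def Let_def I_def by (simp add: powr_numeral)
  show ?thesis
  proof (cases "I = \<infinity>")
    case True
    then show ?thesis unfolding I_def[symmetric] L by (simp add: power2_eq_square ennreal_mult_top)
  next
    case False
    have "(Lp_norm 2 u)\<^sup>2 = ennreal ((enn2real I powr (1 / 2))\<^sup>2)"
      using False unfolding L by (simp add: ennreal_power)
    also have "(enn2real I powr (1 / 2))\<^sup>2 = enn2real I" by (simp add: powr_half_sqrt)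
    also have "ennreal (enn2real I) = I" using False by (simp add: less_top)
    finally show ?thesis unfolding I_def .
  qed
qed

text \<open>For $b = |a| > 0$ the function $y \ln(1 + b^2/y^2) + 2b \arctan(y/b)$ is a primitive on $y > 0$. It tends to $\pi b$ at
  infinity and is nonnegative, so the integral over $[\delta, \infty)$ is at most $\pi b$; Fatou removes
  $\delta$.\<close>
lemma nn_integral_log_kernel:
  "(\<integral>\<^sup>+ y. ennreal (ln (1 + (a / y)\<^sup>2)) \<partial>lborel) \<le> ennreal (2 * pi * \<bar>a\<bar>)"
proof -
  define b where "b = \<bar>a\<bar>"
  let ?k = "\<lambda>y::real. ennreal (ln (1 + (b / y)\<^sup>2))"
  have ab: "(a / y)\<^sup>2 = (b / y)\<^sup>2" for y by (simp add: b_def power_divide)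
  show ?thesis
  proof (cases "a = 0")
    case False
    then have b: "b > 0" by (simp add: b_def)
    define G where "G = (\<lambda>y. y * ln (1 + (b / y)\<^sup>2) + 2 * b * arctan (y / b))"
    have half: "(\<integral>\<^sup>+ y. ?k y * indicator {\<delta>..} y \<partial>lborel) \<le> ennreal (pi * b)" if d: "\<delta> > 0" for \<delta>
    proof -
      have "(\<integral>\<^sup>+ y. ?k y * indicator {\<delta>..} y \<partial>lborel) = ennreal (pi * b - G \<delta>)"
      proof (rule nn_integral_FTC_atLeast)
        fix y assume "\<delta> \<le> y"
        then have y: "y > 0" using d by simp
        let ?p = "1 + (b / y)\<^sup>2"
        have d1: "((\<lambda>y. b / y) has_real_derivative - (b / y\<^sup>2)) (at y)"
          using y by (auto intro!: derivative_eq_intros simp: power2_eq_square)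
        have d2: "((\<lambda>z::real. 1 + z\<^sup>2) has_real_derivative 2 * z) (at z)" for z
          by (auto intro!: derivative_eq_intros)
        have "((\<lambda>y. 1 + (b / y)\<^sup>2) has_real_derivative 2 * (b / y) * - (b / y\<^sup>2)) (at y)"
          by (rule DERIV_chain2[OF d2 d1])
        then have 1: "((\<lambda>y. ln (1 + (b / y)\<^sup>2)) has_real_derivative inverse ?p * (2 * (b / y) * - (b / y\<^sup>2))) (at y)"
          by (intro DERIV_chain2[OF DERIV_ln]) simp_all
        have "((\<lambda>y. y / b) has_real_derivative 1 / b) (at y)" using b by (auto intro!: derivative_eq_intros)
        then have 2: "((\<lambda>y. arctan (y / b)) has_real_derivative inverse (1 + (y / b)\<^sup>2) * (1 / b)) (at y)"
          by (rule DERIV_chain2[OF DERIV_arctan])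
        have "(G has_real_derivative (1 * ln ?p + inverse ?p * (2 * (b / y) * - (b / y\<^sup>2)) * y
            + 2 * b * (inverse (1 + (y / b)\<^sup>2) * (1 / b)))) (at y)"
          unfolding G_def by (intro DERIV_add DERIV_mult DERIV_ident 1 DERIV_cmult 2)
        moreover have "inverse ?p * (2 * (b / y) * - (b / y\<^sup>2)) * y + 2 * b * (inverse (1 + (y / b)\<^sup>2) * (1 / b)) = 0"
        proof -
          have s: "y\<^sup>2 + b\<^sup>2 > 0" using y by (simp add: add_pos_nonneg)
          have p1: "inverse ?p = y\<^sup>2 / (y\<^sup>2 + b\<^sup>2)" using y s by (simp add: field_simps power_divide)
          have p2: "inverse (1 + (y / b)\<^sup>2) = b\<^sup>2 / (y\<^sup>2 + b\<^sup>2)" using b s by (simp add: field_simps power_divide)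
          show ?thesis unfolding p1 p2 using y b s by (simp add: power2_eq_square)
        qed
        ultimately show "(G has_real_derivative ln ?p) (at y)" by (simp add: add.assoc)
      next
        have "((\<lambda>y. y * ln (1 + (b / y)\<^sup>2)) \<longlongrightarrow> 0) at_top"
        proof (rule Lim_null_comparison)
          show "\<forall>\<^sub>F y in at_top. norm (y * ln (1 + (b / y)\<^sup>2)) \<le> b\<^sup>2 / y"
            using eventually_gt_at_top[of 0]
          proof eventually_elim
            case (elim y)
            have "y * ln (1 + (b / y)\<^sup>2) \<le> y * (b / y)\<^sup>2"
              using elim ln_one_plus_square_bounds(2)[of "b / y"] by (intro mult_left_mono) auto
            then show ?case using elim by (simp add: power2_eq_square abs_mult)
          qed
          show "((\<lambda>y. b\<^sup>2 / y) \<longlongrightarrow> 0) at_top"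
            by (intro tendsto_divide_0[OF tendsto_const] filterlim_at_top_imp_at_infinity filterlim_ident)
        qed
        moreover have "((\<lambda>y. arctan (y / b)) \<longlongrightarrow> pi / 2) at_top"
          using b by (intro filterlim_compose[OF tendsto_arctan_at_top]) 
            (simp add: filterlim_at_top_mult_tendsto_pos[of "\<lambda>_. inverse b", OF tendsto_const _ filterlim_ident] divide_inverse)
        ultimately have "(G \<longlongrightarrow> 0 + 2 * b * (pi / 2)) at_top"
          unfolding G_def by (intro tendsto_intros)
        then show "(G \<longlongrightarrow> pi * b) at_top" by (simp add: mult.commute)
      qed auto
      also have "\<dots> \<le> ennreal (pi * b)"
      proof -
        have "G \<delta> \<ge> 0" unfolding G_def using d b by (intro add_nonneg_nonneg mult_nonneg_nonneg) auto
        then show ?thesis by (intro ennreal_leI) simp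
      qed
      finally show ?thesis .
    qed
    have pos: "(\<integral>\<^sup>+ y. ?k y * indicator {0<..} y \<partial>lborel) \<le> ennreal (pi * b)"
    proof -
      have "(\<integral>\<^sup>+ y. ?k y * indicator {0<..} y \<partial>lborel) \<le> (\<integral>\<^sup>+ y. liminf (\<lambda>n. ?k y * indicator {1 / real (Suc n)..} y) \<partial>lborel)"
      proof (rule nn_integral_mono)
        fix y :: real
        show "?k y * indicator {0<..} y \<le> liminf (\<lambda>n. ?k y * indicator {1 / real (Suc n)..} y)"
        proof (cases "y > 0")
          case True
          have "\<forall>\<^sub>F n in sequentially. 1 / real (Suc n) < y"
            by (rule order_tendstoD(2)[OF LIMSEQ_Suc[OF lim_1_over_n] True])
          then have "\<forall>\<^sub>F n in sequentially. ?k y * indicator {0<..} y \<le> ?k y * indicator {1 / real (Suc n)..} y"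
            by eventually_elim (use True in \<open>auto simp: indicator_def\<close>)
          then show ?thesis by (rule Liminf_bounded)
        qed simp
      qed
      also have "\<dots> \<le> liminf (\<lambda>n. \<integral>\<^sup>+ y. ?k y * indicator {1 / real (Suc n)..} y \<partial>lborel)"
        by (rule nn_integral_liminf) measurable
      also have "\<dots> \<le> liminf (\<lambda>n::nat. ennreal (pi * b))"
        by (intro Liminf_mono always_eventually allI half) simp
      finally show ?thesis by (simp add: Liminf_const)
    qed
    have neg: "(\<integral>\<^sup>+ y. ?k y * indicator {..<0} y \<partial>lborel) = (\<integral>\<^sup>+ y. ?k y * indicator {0<..} y \<partial>lborel)"
      by (subst nn_integral_real_affine[of _ "-1" 0]) (auto intro!: nn_integral_cong simp: indicator_def)
    have "(\<integral>\<^sup>+ y. ?k y \<partial>lborel) = (\<integral>\<^sup>+ y. ?k y * indicator {0<..} y + ?k y * indicator {..<0} y \<partial>lborel)"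
    proof (rule nn_integral_cong)
      fix y :: real show "?k y = ?k y * indicator {0<..} y + ?k y * indicator {..<0} y"
        by (cases y "0::real" rule: linorder_cases) auto
    qed
    also have "\<dots> = (\<integral>\<^sup>+ y. ?k y * indicator {0<..} y \<partial>lborel) + (\<integral>\<^sup>+ y. ?k y * indicator {..<0} y \<partial>lborel)"
      by (rule nn_integral_add) measurable
    also have "\<dots> \<le> ennreal (pi * b) + ennreal (pi * b)" unfolding neg by (intro add_mono pos)
    also have "\<dots> = ennreal (2 * pi * \<bar>a\<bar>)" using b by (subst ennreal_plus[symmetric]) (auto simp: b_def)
    finally show ?thesis unfolding ab .
  qed simp
qed

text \<open>From $(p-r)^2 \le 2p^2 + 2r^2$ and $1 + s + t \le (1+s)(1+t)$; the factor $\sqrt 2$ of the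
  final estimate comes from here.\<close>
lemma ln_difference_le:
  fixes a b y :: real
  shows "ln (1 + ((a - b) / y)\<^sup>2) \<le> ln (1 + (sqrt 2 * a / y)\<^sup>2) + ln (1 + (sqrt 2 * b / y)\<^sup>2)"
proof -
  have sq: "(sqrt 2 * c / y)\<^sup>2 = 2 * (c / y)\<^sup>2" for c by (simp add: power_divide power_mult_distrib)
  define p r where "p = a / y" and "r = b / y"
  have "(a - b) / y = p - r" by (simp add: p_def r_def diff_divide_distrib)
  moreover have "1 + (p - r)\<^sup>2 \<le> (1 + 2 * p\<^sup>2) * (1 + 2 * r\<^sup>2)"
  proof -
    have "(1 + 2 * p\<^sup>2) * (1 + 2 * r\<^sup>2) - (1 + (p - r)\<^sup>2) = (p + r)\<^sup>2 + 4 * (p * r)\<^sup>2"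
      by (simp add: power2_eq_square algebra_simps)
    moreover have "\<dots> \<ge> 0" by simp
    ultimately show ?thesis by linarith
  qed
  then have "ln (1 + (p - r)\<^sup>2) \<le> ln ((1 + 2 * p\<^sup>2) * (1 + 2 * r\<^sup>2))"
    by (subst ln_le_cancel_iff) (auto simp: add_pos_nonneg)
  moreover have "ln ((1 + 2 * p\<^sup>2) * (1 + 2 * r\<^sup>2)) = ln (1 + 2 * p\<^sup>2) + ln (1 + 2 * r\<^sup>2)"
    by (rule ln_mult_pos) (auto simp: add_pos_nonneg)
  ultimately show ?thesis unfolding sq p_def r_def by simp
qed

lemma nn_log_le_L1:
  fixes u :: "real \<Rightarrow> real"
  assumes [measurable]: "u \<in> borel_measurable borel"
  shows "(\<integral>\<^sup>+ x. (\<integral>\<^sup>+ \<alpha>. ennreal (ln (1 + ((u x - u \<alpha>) / (x - \<alpha>))\<^sup>2)) \<partial>lborel) \<partial>lborel)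
     \<le> ennreal (4 * pi * sqrt 2) * (\<integral>\<^sup>+ x. ennreal \<bar>u x\<bar> \<partial>lborel)"
proof -
  let ?L = "\<lambda>a y. ennreal (ln (1 + (sqrt 2 * a / y)\<^sup>2))"
  have ker: "(\<integral>\<^sup>+ y. ?L a y \<partial>lborel) \<le> ennreal (2 * pi * sqrt 2) * ennreal \<bar>a\<bar>" for a
    using nn_integral_log_kernel[of "sqrt 2 * a"] by (simp add: abs_mult ennreal_mult'[symmetric] mult.assoc)
  have cm: "(\<integral>\<^sup>+ x. ennreal (2 * pi * sqrt 2) * ennreal \<bar>u x\<bar> \<partial>lborel) = ennreal (2 * pi * sqrt 2) * (\<integral>\<^sup>+ x. ennreal \<bar>u x\<bar> \<partial>lborel)"
    by (rule nn_integral_cmult) measurable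
  have s1: "(\<integral>\<^sup>+ \<alpha>. ?L a (x - \<alpha>) \<partial>lborel) = (\<integral>\<^sup>+ y. ?L a y \<partial>lborel)" for a x
    by (subst (2) nn_integral_real_affine[of _ "-1" x]) auto
  have s2: "(\<integral>\<^sup>+ x. ?L a (x - \<alpha>) \<partial>lborel) = (\<integral>\<^sup>+ y. ?L a y \<partial>lborel)" for a \<alpha>
    by (subst (2) nn_integral_real_affine[of _ "1" "-\<alpha>"]) auto
  have "(\<integral>\<^sup>+ x. (\<integral>\<^sup>+ \<alpha>. ennreal (ln (1 + ((u x - u \<alpha>) / (x - \<alpha>))\<^sup>2)) \<partial>lborel) \<partial>lborel)
    \<le> (\<integral>\<^sup>+ x. (\<integral>\<^sup>+ \<alpha>. ?L (u x) (x - \<alpha>) + ?L (u \<alpha>) (x - \<alpha>) \<partial>lborel) \<partial>lborel)"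
  proof (intro nn_integral_mono)
    fix x \<alpha>
    have "ennreal (ln (1 + ((u x - u \<alpha>) / (x - \<alpha>))\<^sup>2)) \<le> 
      ennreal (ln (1 + (sqrt 2 * u x / (x - \<alpha>))\<^sup>2) + ln (1 + (sqrt 2 * u \<alpha> / (x - \<alpha>))\<^sup>2))"
      by (intro ennreal_leI ln_difference_le)
    then show "ennreal (ln (1 + ((u x - u \<alpha>) / (x - \<alpha>))\<^sup>2)) \<le> ?L (u x) (x - \<alpha>) + ?L (u \<alpha>) (x - \<alpha>)"
      by simp
  qed
  also have "\<dots> = (\<integral>\<^sup>+ x. (\<integral>\<^sup>+ \<alpha>. ?L (u x) (x - \<alpha>) \<partial>lborel) \<partial>lborel) + (\<integral>\<^sup>+ x. (\<integral>\<^sup>+ \<alpha>. ?L (u \<alpha>) (x - \<alpha>) \<partial>lborel) \<partial>lborel)"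
    by (subst nn_integral_add[symmetric], measurable)
       (intro nn_integral_cong nn_integral_add, measurable)
  also have "(\<integral>\<^sup>+ x. (\<integral>\<^sup>+ \<alpha>. ?L (u \<alpha>) (x - \<alpha>) \<partial>lborel) \<partial>lborel) = (\<integral>\<^sup>+ \<alpha>. (\<integral>\<^sup>+ x. ?L (u \<alpha>) (x - \<alpha>) \<partial>lborel) \<partial>lborel)"
    by (rule lborel_pair.Fubini') measurable
  also have "(\<integral>\<^sup>+ x. (\<integral>\<^sup>+ \<alpha>. ?L (u x) (x - \<alpha>) \<partial>lborel) \<partial>lborel) + (\<integral>\<^sup>+ \<alpha>. (\<integral>\<^sup>+ x. ?L (u \<alpha>) (x - \<alpha>) \<partial>lborel) \<partial>lborel)
     \<le> (\<integral>\<^sup>+ x. ennreal (2 * pi * sqrt 2) * ennreal \<bar>u x\<bar> \<partial>lborel) + (\<integral>\<^sup>+ x. ennreal (2 * pi * sqrt 2) * ennreal \<bar>u x\<bar> \<partial>lborel)"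
    unfolding s1 s2 by (intro add_mono nn_integral_mono ker)
  also have "\<dots> = (ennreal (2 * pi * sqrt 2) + ennreal (2 * pi * sqrt 2)) * (\<integral>\<^sup>+ x. ennreal \<bar>u x\<bar> \<partial>lborel)"
    by (simp only: distrib_right cm)
  also have "ennreal (2 * pi * sqrt 2) + ennreal (2 * pi * sqrt 2) = ennreal (4 * pi * sqrt 2)"
    by (subst ennreal_plus[symmetric]) auto
  finally show ?thesis .
qed

section \<open>Integration in time\<close>

text \<open>Functions continuous in the first variable and measurable in the second are jointly measurable:
  freeze the first variable at $\lfloor n x \rfloor / n$, which takes countably many values, and let $n \to \infty$.\<close>
lemma measurable_separately:
  fixes h :: "real \<Rightarrow> real \<Rightarrow> real"
  assumes c: "\<And>s. continuous_on UNIV (\<lambda>x. h x s)" and m: "\<And>x. h x \<in> borel_measurable borel"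
  shows "(\<lambda>(x, s). h x s) \<in> borel_measurable (borel \<Otimes>\<^sub>M borel)"
proof (rule borel_measurable_LIMSEQ_real)
  fix n :: nat
  show "(\<lambda>p. h (of_int \<lfloor>real (Suc n) * fst p\<rfloor> / real (Suc n)) (snd p)) \<in> borel_measurable (borel \<Otimes>\<^sub>M borel)"
  proof (rule measurable_compose_countable[where f = "\<lambda>i p. h (of_int i / real (Suc n)) (snd p)" and g = "\<lambda>p. \<lfloor>real (Suc n) * fst p\<rfloor>"])
    show "(\<lambda>p. h (of_int i / real (Suc n)) (snd p)) \<in> borel_measurable (borel \<Otimes>\<^sub>M borel)" for i
      by (rule measurable_compose[OF measurable_snd m])
  qed measurable
next
  fix p :: "real \<times> real"
  obtain x s where p: "p = (x, s)" by force
  have "(\<lambda>n. of_int \<lfloor>real (Suc n) * x\<rfloor> / real (Suc n)) \<longlonglongrightarrow> x"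
  proof (rule LIMSEQ_I)
    fix e :: real assume "e > 0"
    have "\<forall>\<^sub>F n in sequentially. 1 / real (Suc n) < e"
      by (rule order_tendstoD(2)[OF LIMSEQ_Suc[OF lim_1_over_n] \<open>e > 0\<close>])
    then have "\<forall>\<^sub>F n in sequentially. norm (of_int \<lfloor>real (Suc n) * x\<rfloor> / real (Suc n) - x) < e"
    proof eventually_elim
      case (elim n)
      have "\<bar>of_int \<lfloor>real (Suc n) * x\<rfloor> - real (Suc n) * x\<bar> \<le> 1" by linarith
      then have "\<bar>of_int \<lfloor>real (Suc n) * x\<rfloor> - real (Suc n) * x\<bar> / real (Suc n) \<le> 1 / real (Suc n)"
        by (rule divide_right_mono) simp
      moreover have "of_int \<lfloor>real (Suc n) * x\<rfloor> / real (Suc n) - x = (of_int \<lfloor>real (Suc n) * x\<rfloor> - real (Suc n) * x) / real (Suc n)"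
        by (simp add: field_simps)
      ultimately have "\<bar>of_int \<lfloor>real (Suc n) * x\<rfloor> / real (Suc n) - x\<bar> \<le> 1 / real (Suc n)"
        by (simp only: abs_divide abs_of_nat)
      then show ?case using elim by (simp only: real_norm_def)
    qed
    then show "\<exists>no. \<forall>n\<ge>no. norm (of_int \<lfloor>real (Suc n) * x\<rfloor> / real (Suc n) - x) < e"
      by (simp add: eventually_sequentially)
  qed
  moreover have "isCont (\<lambda>x. h x s) x" using c[of s] by (simp add: continuous_on_eq_continuous_at)
  ultimately have "(\<lambda>n. h (of_int \<lfloor>real (Suc n) * x\<rfloor> / real (Suc n)) s) \<longlonglongrightarrow> h x s"
    by (rule isCont_tendsto_compose[rotated])
  then show "(\<lambda>n. h (of_int \<lfloor>real (Suc n) * fst p\<rfloor> / real (Suc n)) (snd p)) \<longlonglongrightarrow> (case p of (x, s) \<Rightarrow> h x s)"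
    by (simp add: p)
qed

theorem mainTheorem1:
  fixes \<rho>1 \<rho>2 T :: real and f0 :: "real \<Rightarrow> real" and f :: "real \<Rightarrow> real \<Rightarrow> real"
  assumes "\<rho>2 > \<rho>1" and "T > 0" and "muskat_solution \<rho>1 \<rho>2 T f0 f"
  shows "(\<forall>t\<in>{0..T}.
            (Lp_norm 2 (\<lambda>x. f x t))\<^sup>2
              + ennreal ((\<rho>2 - \<rho>1) / (2 * pi)) *
                (\<integral>\<^sup>+ s\<in>{0..t}. (\<integral>\<^sup>+ \<alpha>. (\<integral>\<^sup>+ x.
                   ennreal (ln (1 + ((f x s - f \<alpha> s) / (x - \<alpha>))\<^sup>2))
                 \<partial>lborel) \<partial>lborel) \<partial>lborel)
            = (Lp_norm 2 f0)\<^sup>2)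
       \<and> (\<forall>s\<in>{0..T}.
            (\<integral>\<^sup>+ x. (\<integral>\<^sup>+ \<alpha>.
               ennreal (ln (1 + ((f x s - f \<alpha> s) / (x - \<alpha>))\<^sup>2)) \<partial>lborel) \<partial>lborel)
            \<le> ennreal (4 * pi * sqrt 2) * Lp_norm 1 (\<lambda>x. f x s))"
proof -
  obtain C :: real where C: "\<And>t. t \<in> {0..T} \<Longrightarrow> H2_bounded_by (ennreal C) (\<lambda>x. f x t)"
    and fcont: "\<And>x. continuous_on {0..T} (f x)" and init: "\<And>x. f x 0 = f0 x"
    and eqn: "\<And>t x. t \<in> {0<..<T} \<Longrightarrow> \<exists>I. has_PV_integral (muskat_integrand (\<lambda>y. f y t) x) I \<and>
        (f x has_real_derivative (\<rho>2 - \<rho>1) / (2 * pi) * I) (at t)"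
    using assms(3) unfolding muskat_solution_def by blast
  define D where "D = C\<^sup>2"
  define c where "c = (\<rho>2 - \<rho>1) / (2 * pi)"
  have c: "c > 0" using assms(1) by (simp add: c_def)
  have prof: "\<exists>v w. H2_profile (\<lambda>x. f x t) v w D" if t: "t \<in> {0..T}" for t
  proof -
    obtain v w where vw: "has_ac_deriv (\<lambda>x. f x t) v" "has_ac_deriv v w" 
      "Lp_norm 2 (\<lambda>x. f x t) \<le> ennreal C" "Lp_norm 2 v \<le> ennreal C" "Lp_norm 2 w \<le> ennreal C"
      using C[OF t] unfolding H2_bounded_by_def by blast
    have "(\<integral>\<^sup>+ x. ennreal ((k x)\<^sup>2) \<partial>lborel) \<le> ennreal D" if "Lp_norm 2 k \<le> ennreal C" for k
    proof -
      have "(Lp_norm 2 k)\<^sup>2 \<le> (ennreal C)\<^sup>2" using that by (rule power_mono) simp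
      also have "\<dots> \<le> ennreal D"
        by (cases "C \<ge> 0") (auto simp: D_def ennreal_power ennreal_neg)
      finally show ?thesis unfolding Lp_norm_2_square .
    qed
    then have "H2_profile (\<lambda>x. f x t) v w D"
      using vw by unfold_locales (auto simp: D_def)
    then show ?thesis by blast
  qed
  have fx: "continuous_on UNIV (\<lambda>x. f x t)" if "t \<in> {0..T}" for t
    using prof[OF that] H2_profile.cont_u by blast
  \<comment> \<open>Clamping the time gives a function on the whole plane without changing it on $[0,T]$.\<close>
  define h where "h x s = f x (max 0 (min T s))" for x s
  have hf: "h x s = f x s" if "s \<in> {0..T}" for x s using that by (simp add: h_def)
  have hc: "continuous_on UNIV (h x)" for x
    unfolding h_def using assms(2)
    by (intro continuous_on_compose2[OF fcont] continuous_intros) auto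
  have hm [measurable]: "(\<lambda>(x, s). h x s) \<in> borel_measurable (borel \<Otimes>\<^sub>M borel)"
    using assms(2) by (intro measurable_separately borel_measurable_continuous_onI hc) (auto simp: h_def intro!: fx)
  \<comment> \<open>The time derivative as a sequential limit, so that it is jointly measurable by construction.\<close>
  define g where "g x s = indicator {0<..<T} s * lim (\<lambda>n. real (Suc n) * (h x (s + 1 / real (Suc n)) - h x s))" for x s
  have gm [measurable]: "(\<lambda>(x, s). g x s) \<in> borel_measurable (borel \<Otimes>\<^sub>M borel)"
    unfolding g_def by measurable
  have g0: "g x s = 0" if "s \<notin> {0<..<T}" for x s using that by (simp add: g_def)
  have gD: "(h x has_real_derivative g x s) (at s)" "has_PV_integral (muskat_integrand (\<lambda>y. f y s) x) (g x s / c)"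
    if s: "s \<in> {0<..<T}" for x s
  proof -
    obtain I where I: "has_PV_integral (muskat_integrand (\<lambda>y. f y s) x) I" "(f x has_real_derivative c * I) (at s)"
      using eqn[OF s, of x] unfolding c_def by blast
    have h': "(h x has_real_derivative c * I) (at s)"
      by (rule has_field_derivative_transform_within_open[OF I(2) _ s]) (auto simp: hf)
    have "(\<lambda>n. (h x (s + 1 / real (Suc n)) - h x s) / (1 / real (Suc n))) \<longlonglongrightarrow> c * I"
    proof (rule filterlim_compose[OF h'[unfolded DERIV_def]])
      show "filterlim (\<lambda>n. 1 / real (Suc n)) (at 0) sequentially"
        using LIMSEQ_Suc[OF lim_1_over_n[where 'a = real]] by (simp add: filterlim_at)
    qed
    then have "lim (\<lambda>n. real (Suc n) * (h x (s + 1 / real (Suc n)) - h x s)) = c * I"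
      by (intro limI) (simp add: mult.commute)
    then have "g x s = c * I" using s by (simp add: g_def)
    then show "(h x has_real_derivative g x s) (at s)" "has_PV_integral (muskat_integrand (\<lambda>y. f y s) x) (g x s / c)"
      using h' I(1) c by auto
  qed
  define LL where "LL s = (\<integral>\<^sup>+ \<alpha>. (\<integral>\<^sup>+ x. ennreal (ln (1 + ((f x s - f \<alpha> s) / (x - \<alpha>))\<^sup>2)) \<partial>lborel) \<partial>lborel)" for s
  define B where "B = 6 * D + (2 + D) * (4 * D)"
  have slice: "(\<integral>\<^sup>+ x. ennreal \<bar>2 * h x s * g x s\<bar> \<partial>lborel) \<le> ennreal (2 * c * B)"
      "(LBINT x. 2 * h x s * g x s) \<le> 0"
      "s \<in> {0<..<T} \<Longrightarrow> LL s = ennreal (- (LBINT x. 2 * h x s * g x s) / c)" if s: "s \<in> {0..T}" for s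
  proof -
    have goal: "(\<integral>\<^sup>+ x. ennreal \<bar>2 * h x s * g x s\<bar> \<partial>lborel) \<le> ennreal (2 * c * B) \<and> (LBINT x. 2 * h x s * g x s) \<le> 0
       \<and> LL s = ennreal (- (LBINT x. 2 * h x s * g x s) / c)" if s': "s \<in> {0<..<T}"
    proof -
      obtain v w where "H2_profile (\<lambda>x. f x s) v w D" using prof[OF s] by blast
      then interpret H2_profile "\<lambda>x. f x s" v w D .
      note P = PV_identity[OF gD(2)[OF s']]
      have e: "2 * h x s * g x s = 2 * c * (f x s * (g x s / c))" for x using hf[OF s] c by simp
      have e2: "ennreal \<bar>2 * c * Y\<bar> = ennreal (2 * c) * ennreal \<bar>Y\<bar>" for Y
        using c by (subst ennreal_mult'[symmetric]) (auto simp: abs_mult)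
      have [measurable]: "(\<lambda>x. g x s / c) \<in> borel_measurable borel" by (rule P(1))
      have "(\<integral>\<^sup>+ x. ennreal \<bar>2 * h x s * g x s\<bar> \<partial>lborel) = (\<integral>\<^sup>+ x. ennreal (2 * c) * ennreal \<bar>f x s * (g x s / c)\<bar> \<partial>lborel)"
        unfolding e e2 ..
      also have "\<dots> = ennreal (2 * c) * (\<integral>\<^sup>+ x. ennreal \<bar>f x s * (g x s / c)\<bar> \<partial>lborel)"
        by (rule nn_integral_cmult) measurable
      also have "\<dots> \<le> ennreal (2 * c) * ennreal majorant_bound" by (intro mult_left_mono P(2)) simp
      also have "\<dots> = ennreal (2 * c * B)" unfolding majorant_bound_def B_def using c by (intro ennreal_mult'[symmetric]) simp
      finally have 1: "(\<integral>\<^sup>+ x. ennreal \<bar>2 * h x s * g x s\<bar> \<partial>lborel) \<le> ennreal (2 * c * B)" .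
      have 2: "(LBINT x. 2 * h x s * g x s) = 2 * c * (LBINT x. f x s * (g x s / c))"
        unfolding e by (rule integral_mult_right_zero)
      show ?thesis using 1 P(4,5) c unfolding 2 LL_def by (simp add: mult_nonneg_nonpos divide_le_0_iff)
    qed
    show "s \<in> {0<..<T} \<Longrightarrow> LL s = ennreal (- (LBINT x. 2 * h x s * g x s) / c)" using goal by blast
    show "(\<integral>\<^sup>+ x. ennreal \<bar>2 * h x s * g x s\<bar> \<partial>lborel) \<le> ennreal (2 * c * B)" "(LBINT x. 2 * h x s * g x s) \<le> 0"
      using goal g0[of s] by (cases "s \<in> {0<..<T}"; simp)+
  qed
  have sq_int: "integrable lborel (\<lambda>x. (f x t)\<^sup>2)" 
    "(Lp_norm 2 (\<lambda>x. f x t))\<^sup>2 = ennreal (LBINT x. (f x t)\<^sup>2)" if t: "t \<in> {0..T}" for t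
  proof -
    obtain v w where "H2_profile (\<lambda>x. f x t) v w D" using prof[OF t] by blast
    then interpret H2_profile "\<lambda>x. f x t" v w D .
    show i: "integrable lborel (\<lambda>x. (f x t)\<^sup>2)"
      by (rule integrable_nn_bound[where B = D]) (use u_sq in auto)
    show "(Lp_norm 2 (\<lambda>x. f x t))\<^sup>2 = ennreal (LBINT x. (f x t)\<^sup>2)"
      unfolding Lp_norm_2_square using i by (rule nn_integral_eq_integral) simp
  qed
  show ?thesis
  proof (intro conjI ballI)
    fix t assume t: "t \<in> {0..T}"
    define K where "K x s = indicator {0..t} s * (2 * h x s * g x s)" for x s
    have iK: "integrable (lborel \<Otimes>\<^sub>M lborel) (\<lambda>(x, s). K x s)"
      unfolding K_def
    proof (rule integrable_strip)
      show "(\<lambda>(x, s). 2 * h x s * g x s) \<in> borel_measurable (borel \<Otimes>\<^sub>M borel)" by measurable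
      show "(\<integral>\<^sup>+ x. ennreal \<bar>2 * h x s * g x s\<bar> \<partial>lborel) \<le> ennreal (2 * c * B)" if "s \<in> {0..t}" for s
        using slice(1) t that by auto
    qed
    \<comment> \<open>The fundamental theorem holds for the gauge integral; it agrees with the Lebesgue integral where the slice is integrable, which by Fubini is the case for almost every $x$.\<close>
    have ftc: "(LBINT s. K x s) = (f x t)\<^sup>2 - (f x 0)\<^sup>2" if "integrable lborel (K x)" for x
    proof -
      have si: "set_integrable lborel {0..t} (\<lambda>s. 2 * h x s * g x s)"
        using that unfolding set_integrable_def K_def by simp
      have "((\<lambda>s. 2 * h x s * g x s) has_integral ((h x t)\<^sup>2 - (h x 0)\<^sup>2)) {0..t}"
      proof (rule fundamental_theorem_of_calculus_interior)
        show "continuous_on {0..t} (\<lambda>s. (h x s)\<^sup>2)"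
          by (intro continuous_intros continuous_on_subset[OF hc]) auto
        fix s assume "s \<in> {0<..<t}"
        then have "s \<in> {0<..<T}" using t by auto
        from gD(1)[OF this, of x]
        show "((\<lambda>s. (h x s)\<^sup>2) has_vector_derivative 2 * h x s * g x s) (at s)"
          unfolding has_real_derivative_iff_has_vector_derivative[symmetric]
          by (auto intro!: derivative_eq_intros)
      qed (use t in auto)
      then show ?thesis
        using set_borel_integral_eq_integral(2)[OF si] t hf[of 0 x] hf[of t x] unfolding K_def set_lebesgue_integral_def
        by (simp add: integral_unique)
    qed
    have "(LBINT x. (f x t)\<^sup>2 - (f x 0)\<^sup>2) = (LBINT x. LBINT s. K x s)"
    proof (rule integral_cong_AE)
      show "AE x in lborel. (f x t)\<^sup>2 - (f x 0)\<^sup>2 = (LBINT s. K x s)"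
        using lborel_pair.AE_integrable_fst'[OF iK] by eventually_elim (simp add: ftc)
      show "(\<lambda>x. (f x t)\<^sup>2 - (f x 0)\<^sup>2) \<in> borel_measurable lborel"
        using sq_int(1)[OF t] sq_int(1)[of 0] assms(2) by (intro borel_measurable_diff) auto
      show "(\<lambda>x. LBINT s. K x s) \<in> borel_measurable lborel" 
        using lborel_pair.integrable_fst'[OF iK] by auto
    qed
    also have "\<dots> = (LBINT s. LBINT x. K x s)"
      by (rule lborel_pair.Fubini_integral[OF iK, symmetric])
    \<comment> \<open>Fubini in $(x,s)$ is justified by the bound on time slices that is uniform in $s$.\<close>
    finally have energy: "(LBINT x. (f x t)\<^sup>2) - (LBINT x. (f x 0)\<^sup>2) = (LBINT s. LBINT x. K x s)"
      using sq_int(1)[OF t] sq_int(1)[of 0] assms(2) by simp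
    have nonneg: "0 \<le> - (LBINT x. K x s) / c" for s
      using slice(2)[of s] t c unfolding K_def by (cases "s \<in> {0..t}") (auto simp: divide_nonpos_pos)
    have "(\<integral>\<^sup>+ s\<in>{0..t}. LL s \<partial>lborel) = (\<integral>\<^sup>+ s. ennreal (- (LBINT x. K x s) / c) \<partial>lborel)"
    proof (rule nn_integral_cong_AE)
      have "AE s in lborel. s \<noteq> 0 \<and> s \<noteq> T" by (intro AE_conjI AE_lborel_singleton)
      then show "AE s in lborel. LL s * indicator {0..t} s = ennreal (- (LBINT x. K x s) / c)"
      proof eventually_elim
        case (elim s)
        show ?case
        proof (cases "s \<in> {0..t}")
          case True
          then have "s \<in> {0<..<T}" using elim t by auto
          then show ?thesis using slice(3)[of s] True by (simp add: K_def)
        qed (simp add: K_def)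
      qed
    qed
    also have "\<dots> = ennreal (LBINT s. - (LBINT x. K x s) / c)"
      using lborel_pair.integrable_snd[OF iK] nonneg by (intro nn_integral_eq_integral) auto
    also have "(LBINT s. - (LBINT x. K x s) / c) = ((LBINT x. (f x 0)\<^sup>2) - (LBINT x. (f x t)\<^sup>2)) / c"
      by (simp add: energy[symmetric] diff_divide_distrib)
    finally have Z: "(\<integral>\<^sup>+ s\<in>{0..t}. LL s \<partial>lborel) = ennreal (((LBINT x. (f x 0)\<^sup>2) - (LBINT x. (f x t)\<^sup>2)) / c)" .
    have "0 \<le> (LBINT s. - (LBINT x. K x s) / c)" by (rule Bochner_Integration.integral_nonneg) (rule nonneg)
    then have le: "(LBINT x. (f x t)\<^sup>2) \<le> (LBINT x. (f x 0)\<^sup>2)" 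
      using energy c by (simp add: divide_le_0_iff)
    have "(Lp_norm 2 (\<lambda>x. f x t))\<^sup>2 + ennreal c * (\<integral>\<^sup>+ s\<in>{0..t}. LL s \<partial>lborel) 
      = ennreal (LBINT x. (f x t)\<^sup>2) + ennreal ((LBINT x. (f x 0)\<^sup>2) - (LBINT x. (f x t)\<^sup>2))"
      unfolding Z sq_int(2)[OF t] using c by (simp add: ennreal_mult'[symmetric])
    also have "\<dots> = ennreal (LBINT x. (f x 0)\<^sup>2)"
      using le by (subst ennreal_plus[symmetric]) auto
    also have "\<dots> = (Lp_norm 2 f0)\<^sup>2"
      using sq_int(2)[of 0] assms(2) by (simp add: init)
    finally show "(Lp_norm 2 (\<lambda>x. f x t))\<^sup>2
              + ennreal ((\<rho>2 - \<rho>1) / (2 * pi)) *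
                (\<integral>\<^sup>+ s\<in>{0..t}. (\<integral>\<^sup>+ \<alpha>. (\<integral>\<^sup>+ x.
                   ennreal (ln (1 + ((f x s - f \<alpha> s) / (x - \<alpha>))\<^sup>2))
                 \<partial>lborel) \<partial>lborel) \<partial>lborel)
            = (Lp_norm 2 f0)\<^sup>2"
      unfolding LL_def c_def .
  next
    fix s assume "s \<in> {0..T}"
    then show "(\<integral>\<^sup>+ x. (\<integral>\<^sup>+ \<alpha>.
               ennreal (ln (1 + ((f x s - f \<alpha> s) / (x - \<alpha>))\<^sup>2)) \<partial>lborel) \<partial>lborel)
            \<le> ennreal (4 * pi * sqrt 2) * Lp_norm 1 (\<lambda>x. f x s)"
      unfolding Lp_norm_1 by (intro nn_log_le_L1 borel_measurable_continuous_onI fx)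
  qed
qed

end
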